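(* In the setting below, let $F_1,\dots,F_n\in K_w[\mathcal G\oplus\mathcal H]$ be nonzero, with $x$-initial terms $a_ix_1^{b_{i1}}\cdots x_n^{b_{in}}$ ($a_i\in K_w[\mathcal G]$), and suppose $j(F_1,\dots,F_n)=\det(b_{ij})\ne0$. Then for every $\Phi(\mathbf x)=\sum_{\mathbf k}\phi_{\mathbf k}\mathbf x^{\mathbf k}\in K_w^{\mathbf f}[\mathcal G\oplus\mathcal H]$, the series $\Phi(F_1,\dots,F_n)$ exists in $K_w[\mathcal G\oplus\mathcal H]$ and $$\mathop{\mathrm{Res}}_{\mathbf x}\Phi(F_1,\dots,F_n)\,J(F_1,\dots,F_n)=j(F_1,\dots,F_n)\,\mathop{\mathrm{Res}}_{\mathbf F}\Phi(F_1,\dots,F_n),$$ equivalently $$\mathop{\mathrm{CT}}_{\mathbf x}\Phi(F_1,\dots,F_n)\,LJ(F_1,\dots,F_n)=j(F_1,\dots,F_n)\,\mathop{\mathrm{CT}}_{\mathbf F}\Phi(F_1,\dots,F_n),$$ where the left-hand sides are computed in $K_w[\mathcal G\oplus\mathcal H]$ and $\mathop{\mathrm{Res}}_{\mathbf F}\Phi(\mathbf F)=\phi_{(-1,\dots,-1)}$, $\mathop{\mathrm{CT}}_{\mathbf F}\Phi(\mathbf F)=\phi_{\mathbf 0}$ are the coefficients of $\Phi(\mathbf x)$ regarded as an element of $K_w^{\mathbf f}[\mathcal G\oplus\mathcal H]$.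
   Context: $K$ is a field; a TOA-group is an abelian group with a translation-invariant total order; for a TOA-group $\mathcal A$, $K_w[\mathcal A]$ is the field of formal series $\sum c_at^a$ with well-ordered support; initial term = term of least order. Setting: $\mathcal G,\mathcal H$ abelian groups, $\mathcal H\cong\mathbb Z^n$ with basis $e_1,\dots,e_n$, and $\mathcal G\oplus\mathcal H$ carries a total order making it a TOA-group. Write $x_i=t^{e_i}$; every $\eta\in K_w[\mathcal G\oplus\mathcal H]$ is $\sum_{\mathbf k\in\mathbb Z^n}b_{\mathbf k}\mathbf x^{\mathbf k}$ with $b_{\mathbf k}\in K_w[\mathcal G]$; the $x$-initial term is the nonzero $b_{\mathbf k}\mathbf x^{\mathbf k}$ of least order. Operators: $\partial/\partial x_i$ acts termwise on exponents of $x_i$; $\mathop{\mathrm{CT}}_{\mathbf x}\eta=b_{\mathbf 0}$; $\mathop{\mathrm{Res}}_{\mathbf x}\eta=b_{(-1,\dots,-1)}$. Jacobian $J(F_1,\dots,F_n)=\det(\partial F_i/\partial x_j)$; log Jacobian $LJ(F_1,\dots,F_n)=\frac{x_1\cdots x_n}{F_1\cdots F_n}J(F_1,\dots,F_n)$; Jacobian number $j(F_1,\dots,F_n)=\det(b_{ij})$ where $a_i\mathbf x^{\mathbf b_i}$ is the $x$-initial term of $F_i$. For an injective endomorphism $\rho$ of $\mathcal G\oplus\mathcal H$, $a\le^\rho b\iff\rho(a)\le\rho(b)$, and $K_w^\rho[\mathcal G\oplus\mathcal H]$ is the field of formal series with support well-ordered for $\le^\rho$. If the initial term of $F_i$ is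 $c_it^{g_i}\mathbf x^{\mathbf b_i}$ ($c_i\in K$), $\mathbf f$ is the endomorphism fixing $\mathcal G$ with $e_i\mapsto g_i+\sum_jb_{ij}e_j$, and $K_w^{\mathbf f}=K_w^{\rho}$ with $\rho=\mathbf f$. For $\Phi=\sum_{\mathbf k}\phi_{\mathbf k}\mathbf x^{\mathbf k}$, $\Phi(F_1,\dots,F_n)=\sum_{\mathbf k}\phi_{\mathbf k}F_1^{k_1}\cdots F_n^{k_n}$ (strictly convergent sum). *)

theory Defs
  imports "HOL-Analysis.Analysis" "HOL-Library.Product_Plus"
begin

definition toa :: "('a::ab_group_add \<Rightarrow> 'a \<Rightarrow> bool) \<Rightarrow> bool" where
  "toa le \<longleftrightarrow> (\<forall>a. le a a) \<and> (\<forall>a b. le a b \<and> le b a \<longrightarrow> a = b)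
     \<and> (\<forall>a b c. le a b \<and> le b c \<longrightarrow> le a c) \<and> (\<forall>a b. le a b \<or> le b a)
     \<and> (\<forall>a b c. le a b \<longrightarrow> le (a + c) (b + c))"

definition wo_on :: "('a \<Rightarrow> 'a \<Rightarrow> bool) \<Rightarrow> 'a set \<Rightarrow> bool" where
  "wo_on le S \<longleftrightarrow> (\<forall>T \<subseteq> S. T \<noteq> {} \<longrightarrow> (\<exists>m\<in>T. \<forall>x\<in>T. le m x))"

definition hsupp :: "('a \<Rightarrow> 'k::zero) \<Rightarrow> 'a set" where
  "hsupp f = {a. f a \<noteq> 0}"

text \<open>The Hahn field K_w[A]: formal series sum c_a t^a, represented by
their coefficient functions, with well-ordered support.\<close>
definition hahn :: "('a \<Rightarrow> 'a \<Rightarrow> bool) \<Rightarrow> ('a \<Rightarrow> 'k::zero) set" where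
  "hahn le = {f. wo_on le (hsupp f)}"

definition hone :: "'a::zero \<Rightarrow> 'k::{zero,one}" where
  "hone = (\<lambda>a. if a = 0 then 1 else 0)"

definition tpow :: "'a \<Rightarrow> 'a \<Rightarrow> 'k::{zero,one}" where
  "tpow a = (\<lambda>b. if b = a then 1 else 0)"

text \<open>Product of formal series (convolution; finite sums for well-ordered supports).\<close>
definition hmul :: "('a::plus \<Rightarrow> 'k::comm_ring_1) \<Rightarrow> ('a \<Rightarrow> 'k) \<Rightarrow> 'a \<Rightarrow> 'k" where
  "hmul f g = (\<lambda>c. \<Sum>(a, b) \<in> {(a, b). a + b = c \<and> f a \<noteq> 0 \<and> g b \<noteq> 0}. f a * g b)"

definition hinv :: "('a::ab_group_add \<Rightarrow> 'a \<Rightarrow> bool) \<Rightarrow> ('a \<Rightarrow> 'k::field) \<Rightarrow> 'a \<Rightarrow> 'k" where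
  "hinv le f = (THE g. g \<in> hahn le \<and> hmul f g = hone)"

definition hpow :: "('a::ab_group_add \<Rightarrow> 'a \<Rightarrow> bool) \<Rightarrow> ('a \<Rightarrow> 'k::field) \<Rightarrow> int \<Rightarrow> 'a \<Rightarrow> 'k" where
  "hpow le f k = (if 0 \<le> k then (hmul f ^^ nat k) hone else (hmul (hinv le f) ^^ nat (- k)) hone)"

text \<open>Product of finitely many series indexed by a finite type (taken along
an enumeration of the index type; independent of the enumeration on K_w[A]).\<close>
definition hprod :: "('n::finite \<Rightarrow> 'a::ab_group_add \<Rightarrow> 'k::field) \<Rightarrow> 'a \<Rightarrow> 'k" where
  "hprod u = foldr hmul (map u (SOME xs. distinct xs \<and> set xs = (UNIV :: 'n set))) hone"

definition hsummable :: "('a \<Rightarrow> 'a \<Rightarrow> bool) \<Rightarrow> ('i \<Rightarrow> 'a \<Rightarrow> 'k::zero) \<Rightarrow> 'i set \<Rightarrow> bool" where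
  "hsummable le s I \<longleftrightarrow> (\<forall>i\<in>I. s i \<in> hahn le) \<and> wo_on le (\<Union>i\<in>I. hsupp (s i))
      \<and> (\<forall>a. finite {i \<in> I. s i a \<noteq> 0})"

definition hsum :: "('i \<Rightarrow> 'a \<Rightarrow> 'k::comm_monoid_add) \<Rightarrow> 'i set \<Rightarrow> 'a \<Rightarrow> 'k" where
  "hsum s I = (\<lambda>a. \<Sum>i \<in> {i \<in> I. s i a \<noteq> 0}. s i a)"

text \<open>Elements of G \<oplus> H are pairs (g, h) with h :: int^'n; x_i = t^(0, e_i).\<close>

definition xvar :: "'n::finite \<Rightarrow> ('g::ab_group_add \<times> (int^'n)) \<Rightarrow> 'k::field" where
  "xvar i = tpow (0, axis i 1)"

text \<open>Partial derivative d/dx_i: x^k maps to k_i x^(k - e_i).\<close>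
definition hpderiv :: "'n::finite \<Rightarrow> ('g::ab_group_add \<times> (int^'n) \<Rightarrow> 'k::field) \<Rightarrow> 'g \<times> (int^'n) \<Rightarrow> 'k" where
  "hpderiv i f = (\<lambda>(g, h). of_int (h $ i + 1) * f (g, h + axis i 1))"

definition CTx :: "('g \<times> (int^'n::finite) \<Rightarrow> 'k) \<Rightarrow> 'g \<Rightarrow> 'k" where
  "CTx f = (\<lambda>g. f (g, 0))"

definition Resx :: "('g \<times> (int^'n::finite) \<Rightarrow> 'k) \<Rightarrow> 'g \<Rightarrow> 'k" where
  "Resx f = (\<lambda>g. f (g, - 1))"

text \<open>The coefficient b_k \<in> K_w[G] of x^k, embedded into K_w[G \<oplus> H].\<close>
definition xcoeff :: "('g::ab_group_add \<times> (int^'n::finite) \<Rightarrow> 'k::zero) \<Rightarrow> int^'n \<Rightarrow> 'g \<times> (int^'n) \<Rightarrow> 'k" where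
  "xcoeff f k = (\<lambda>(g, h). if h = 0 then f (g, k) else 0)"

definition xslice :: "('g \<times> (int^'n::finite) \<Rightarrow> 'k::zero) \<Rightarrow> int^'n \<Rightarrow> 'g \<times> (int^'n) \<Rightarrow> 'k" where
  "xslice f k = (\<lambda>(g, h). if h = k then f (g, h) else 0)"

definition init_exp :: "('a \<Rightarrow> 'a \<Rightarrow> bool) \<Rightarrow> ('a \<Rightarrow> 'k::zero) \<Rightarrow> 'a" where
  "init_exp le f = (THE a. a \<in> hsupp f \<and> (\<forall>b\<in>hsupp f. le a b))"

definition xinit :: "('g \<times> (int^'n) \<Rightarrow> 'g \<times> (int^'n) \<Rightarrow> bool) \<Rightarrow> ('g \<times> (int^'n::finite) \<Rightarrow> 'k::zero) \<Rightarrow> int^'n" where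
  "xinit le f = (THE k. xslice f k \<noteq> (\<lambda>_. 0) \<and>
      (\<forall>k'. xslice f k' \<noteq> (\<lambda>_. 0) \<longrightarrow> le (init_exp le (xslice f k)) (init_exp le (xslice f k'))))"

definition jacnum :: "('g \<times> (int^'n) \<Rightarrow> 'g \<times> (int^'n) \<Rightarrow> bool) \<Rightarrow> ('n::finite \<Rightarrow> 'g \<times> (int^'n) \<Rightarrow> 'k::zero) \<Rightarrow> int" where
  "jacnum le F = det (\<chi> i j. xinit le (F i) $ j)"

definition hdet :: "('n::finite \<Rightarrow> 'n \<Rightarrow> 'g::ab_group_add \<times> (int^'n) \<Rightarrow> 'k::field) \<Rightarrow> 'g \<times> (int^'n) \<Rightarrow> 'k" where
  "hdet M = (\<lambda>a. \<Sum>p \<in> {p. p permutes (UNIV :: 'n set)}. of_int (sign p) * hprod (\<lambda>i. M i (p i)) a)"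

definition jacobian :: "('n::finite \<Rightarrow> 'g::ab_group_add \<times> (int^'n) \<Rightarrow> 'k::field) \<Rightarrow> 'g \<times> (int^'n) \<Rightarrow> 'k" where
  "jacobian F = hdet (\<lambda>i j. hpderiv j (F i))"

definition logjacobian :: "('g \<times> (int^'n) \<Rightarrow> 'g \<times> (int^'n) \<Rightarrow> bool) \<Rightarrow> ('n::finite \<Rightarrow> 'g::ab_group_add \<times> (int^'n) \<Rightarrow> 'k::field) \<Rightarrow> 'g \<times> (int^'n) \<Rightarrow> 'k" where
  "logjacobian le F = hmul (hmul (hprod xvar) (hinv le (hprod F))) (jacobian F)"

definition zmul :: "int \<Rightarrow> 'g::ab_group_add \<Rightarrow> 'g" where
  "zmul k g = (if 0 \<le> k then (\<Sum>_ \<in> {0..<nat k}. g) else - (\<Sum>_ \<in> {0..<nat (- k)}. g))"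

text \<open>The endomorphism f: fixes G, e_i \<mapsto> g_i + sum_j b_ij e_j, where the initial term
of F_i is c_i t^(g_i) x^(b_i).\<close>
definition fendo :: "('g \<times> (int^'n) \<Rightarrow> 'g \<times> (int^'n) \<Rightarrow> bool) \<Rightarrow> ('n::finite \<Rightarrow> 'g::ab_group_add \<times> (int^'n) \<Rightarrow> 'k::zero)
     \<Rightarrow> 'g \<times> (int^'n) \<Rightarrow> 'g \<times> (int^'n)" where
  "fendo le F = (\<lambda>(g, h). (g + (\<Sum>i\<in>UNIV. zmul (h $ i) (fst (init_exp le (F i)))),
                           (\<Sum>i\<in>UNIV. h $ i *s snd (init_exp le (F i)))))"

definition fle :: "('g \<times> (int^'n) \<Rightarrow> 'g \<times> (int^'n) \<Rightarrow> bool) \<Rightarrow> ('n::finite \<Rightarrow> 'g::ab_group_add \<times> (int^'n) \<Rightarrow> 'k::zero)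
     \<Rightarrow> 'g \<times> (int^'n) \<Rightarrow> 'g \<times> (int^'n) \<Rightarrow> bool" where
  "fle le F a b = le (fendo le F a) (fendo le F b)"

definition Fpow :: "('g \<times> (int^'n) \<Rightarrow> 'g \<times> (int^'n) \<Rightarrow> bool) \<Rightarrow> ('n::finite \<Rightarrow> 'g::ab_group_add \<times> (int^'n) \<Rightarrow> 'k::field)
     \<Rightarrow> int^'n \<Rightarrow> 'g \<times> (int^'n) \<Rightarrow> 'k" where
  "Fpow le F k = hprod (\<lambda>i. hpow le (F i) (k $ i))"

definition subst_terms :: "('g \<times> (int^'n) \<Rightarrow> 'g \<times> (int^'n) \<Rightarrow> bool) \<Rightarrow> ('g::ab_group_add \<times> (int^'n::finite) \<Rightarrow> 'k::field)
     \<Rightarrow> ('n \<Rightarrow> 'g \<times> (int^'n) \<Rightarrow> 'k) \<Rightarrow> int^'n \<Rightarrow> 'g \<times> (int^'n) \<Rightarrow> 'k" where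
  "subst_terms le Phi F k = hmul (xcoeff Phi k) (Fpow le F k)"

definition subst :: "('g \<times> (int^'n) \<Rightarrow> 'g \<times> (int^'n) \<Rightarrow> bool) \<Rightarrow> ('g::ab_group_add \<times> (int^'n::finite) \<Rightarrow> 'k::field)
     \<Rightarrow> ('n \<Rightarrow> 'g \<times> (int^'n) \<Rightarrow> 'k) \<Rightarrow> 'g \<times> (int^'n) \<Rightarrow> 'k" where
  "subst le Phi F = hsum (subst_terms le Phi F) UNIV"

end

theory Submission
  imports Defs "HOL-Library.Poly_Mapping"
begin

text \<open>
  Write \<open>F\<^sub>i = c\<^sub>i t\<^bsup>a\<^sub>i\<^esup> u\<^sub>i\<close> with \<open>u\<^sub>i = 1 + \<epsilon>\<^sub>i\<close> and \<open>\<epsilon>\<^sub>i\<close> of positive support. By Neumann's lemma the monoid \<open>W\<close>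
  generated by the supports of the \<open>\<epsilon>\<^sub>i\<close> is well-ordered, and the support of \<open>F\<^sup>k\<close> lies in \<open>\<^bold>f(k) + W\<close>;
  this gives the summability of \<open>\<Phi>(F)\<close> and reduces the theorem to \<open>CT F\<^sup>k LJ(F)\<close>, where
  \<open>LJ(F) = det(dlog F\<^sub>i)\<close>. If \<open>k\<^sub>i \<noteq> 0\<close>, row operations turn \<open>k\<^sub>i F\<^sup>k LJ(F)\<close> into the determinant with
  \<open>i\<close>-th row \<open>d(F\<^sup>k)\<close>, a divergence since the other rows are closed forms. If \<open>k = 0\<close>, then
  \<open>dlog F\<^sub>i = b\<^sub>i + dlog u\<^sub>i\<close>, and a determinant with a row \<open>dlog u\<close> has constant term zero: as
  \<open>m u\<^sup>m dlog u = d(u\<^sup>m)\<close>, only the term \<open>m = 0\<close> of the expansion of \<open>(u - 1)\<^sup>M\<close> can contribute, while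
  \<open>(u - 1)\<^sup>M\<close> contributes nothing to a given coefficient for large \<open>M\<close>.

  Both arguments divide by integers. To cover positive characteristic they are carried out over the
  integral monoid ring of the multiplicative monoid of \<open>K\<close>, which is torsion-free and maps onto \<open>K\<close>
  in such a way that the \<open>c\<^sub>i\<close> lift to units.
\<close>

section \<open>Well-ordered subsets of ordered groups\<close>

locale toa_group =
  fixes le :: "'a::ab_group_add \<Rightarrow> 'a \<Rightarrow> bool" (infix "\<preceq>" 50)
  assumes toa: "toa le"
begin

lemma le_refl [simp]: "a \<preceq> a"
  and le_antisym: "a \<preceq> b \<Longrightarrow> b \<preceq> a \<Longrightarrow> a = b"
  and le_trans: "a \<preceq> b \<Longrightarrow> b \<preceq> c \<Longrightarrow> a \<preceq> c"
  and le_total: "a \<preceq> b \<or> b \<preceq> a"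
  and le_add_right: "a \<preceq> b \<Longrightarrow> a + c \<preceq> b + c"
  using toa unfolding toa_def by blast+

lemma le_add_left: "a \<preceq> b \<Longrightarrow> c + a \<preceq> c + b"
  using le_add_right[of a b c] by (simp add: add.commute)

lemma le_add_cancel_left [simp]: "c + a \<preceq> c + b \<longleftrightarrow> a \<preceq> b"
  using le_add_left[of a b c] le_add_left[of "c + a" "c + b" "- c"] by auto

lemma le_add_cancel_right [simp]: "a + c \<preceq> b + c \<longleftrightarrow> a \<preceq> b"
  using le_add_cancel_left[of c a b] by (simp add: add.commute)

lemma le_add_mono: "a \<preceq> b \<Longrightarrow> c \<preceq> d \<Longrightarrow> a + c \<preceq> b + d"
  using le_add_right le_add_left le_trans by blast

section \<open>Nondecreasing subsequences, and closure of well-ordered sets under unions and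
  sums\<close>

lemma wo_on_subseq:
  assumes "wo_on le S" "\<And>n::nat. f n \<in> S"
  obtains r :: "nat \<Rightarrow> nat" where "strict_mono r" "\<And>m n. m \<le> n \<Longrightarrow> f (r m) \<preceq> f (r n)"
proof -
  have "\<exists>m>n. \<forall>k>n. f m \<preceq> f k" for n
  proof -
    have "f ` {n<..} \<subseteq> S" "f ` {n<..} \<noteq> {}" using assms(2) by auto
    then obtain x where "x \<in> f ` {n<..}" "\<forall>y\<in>f ` {n<..}. x \<preceq> y"
      using assms(1) unfolding wo_on_def by blast
    then show ?thesis by auto
  qed
  then obtain h where h: "\<And>n. h n > n" "\<And>n k. k > n \<Longrightarrow> f (h n) \<preceq> f k" by metis
  \<comment> \<open>\<open>h n\<close> is an index beyond \<open>n\<close> at which \<open>f\<close>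
    attains its minimum over that tail. The iteration starts at \<open>h 0\<close> instead of
    \<open>0\<close>, so that already the first chosen value is minimal among all later
    ones.\<close>
  define r where "r n = (h ^^ Suc n) 0" for n
  have r: "strict_mono r" unfolding r_def by (rule strict_monoI_Suc) (simp add: h)
  have step: "f (r n) \<preceq> f (r (Suc n))" for n
  proof (cases n)
    case 0
    have "0 < h (h 0)" using h(1)[of 0] h(1)[of "h 0"] by linarith
    then show ?thesis using 0 by (auto simp: r_def intro!: h(2))
  next
    case (Suc m)
    have "r n = h (r m)" by (simp add: r_def Suc)
    moreover have "r m < r (Suc n)" using r Suc by (simp add: strict_mono_def)
    ultimately show ?thesis using h(2) by metis
  qed
  have "f (r m) \<preceq> f (r n)" if "m \<le> n" for m n
    using that by (induction n rule: dec_induct) (auto intro: le_trans step)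
  with r show ?thesis by (rule that)
qed

text \<open>In a nonempty subset without least element, dependent choice produces a strictly
  decreasing sequence, and by totality such a sequence has no nondecreasing pair.\<close>

lemma wo_onI_seq:
  assumes "\<And>f. (\<And>n::nat. f n \<in> S) \<Longrightarrow> \<exists>i j. i < j \<and> f i \<preceq> f j"
  shows "wo_on le S"
  unfolding wo_on_def
proof (intro allI impI)
  fix T assume T: "T \<subseteq> S" "T \<noteq> {}"
  show "\<exists>m\<in>T. \<forall>x\<in>T. m \<preceq> x"
  proof (rule ccontr)
    assume "\<not> ?thesis"
    then have next_elt: "\<exists>y. y \<in> T \<and> \<not> x \<preceq> y" if "x \<in> T" for x using that by blast
    have "\<exists>f. \<forall>n::nat. f n \<in> T \<and> \<not> f n \<preceq> f (Suc n)"
      by (rule dependent_nat_choice) (use T next_elt in auto)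
    then obtain f where f: "\<And>n::nat. f n \<in> T" "\<And>n. \<not> f n \<preceq> f (Suc n)" by blast
    have desc: "\<not> f m \<preceq> f n" if "m < n" for m n
      using that
    proof (induction n rule: less_Suc_induct)
      case (1 i)
      then show ?case by (rule f(2))
    next
      case (2 i j k)
      then show ?case using le_total[of "f j" "f k"] le_trans[of "f i" "f k" "f j"] by blast
    qed
    from assms[of f] f(1) T(1) obtain i j where "i < j" "f i \<preceq> f j" by blast
    then show False using desc by blast
  qed
qed

lemma wo_on_subset: "wo_on le S \<Longrightarrow> T \<subseteq> S \<Longrightarrow> wo_on le T"
  unfolding wo_on_def by blast

lemma wo_on_seq_le:
  assumes "wo_on le S" "\<And>n::nat. f n \<in> S"
  shows "\<exists>i j. i < j \<and> f i \<preceq> f j"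
proof -
  obtain r :: "nat \<Rightarrow> nat" where r: "strict_mono r" "\<And>m n. m \<le> n \<Longrightarrow> f (r m) \<preceq> f (r n)"
    using wo_on_subseq[of S f] assms by metis
  have "r 0 < r 1" using r(1) by (simp add: strict_mono_less)
  moreover have "f (r 0) \<preceq> f (r 1)" using r(2) by simp
  ultimately show ?thesis by blast
qed

lemma wo_on_Un:
  assumes "wo_on le S" "wo_on le T"
  shows "wo_on le (S \<union> T)"
  unfolding wo_on_def
proof (intro allI impI)
  fix U assume U: "U \<subseteq> S \<union> T" "U \<noteq> {}"
  consider "U \<inter> S = {}" | "U \<inter> T = {}" | "U \<inter> S \<noteq> {}" "U \<inter> T \<noteq> {}" by blast
  then show "\<exists>m\<in>U. \<forall>x\<in>U. m \<preceq> x"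
  proof cases
    case 1
    then show ?thesis using U assms(2) unfolding wo_on_def by blast
  next
    case 2
    then show ?thesis using U assms(1) unfolding wo_on_def by blast
  next
    case 3
    obtain a where a: "a \<in> U \<inter> S" "\<forall>x\<in>U \<inter> S. a \<preceq> x"
      using assms(1) 3(1) unfolding wo_on_def by (metis Int_lower2)
    obtain b where b: "b \<in> U \<inter> T" "\<forall>x\<in>U \<inter> T. b \<preceq> x"
      using assms(2) 3(2) unfolding wo_on_def by (metis Int_lower2)
    show ?thesis
    proof (cases "a \<preceq> b")
      case True
      then have "\<forall>x\<in>U. a \<preceq> x" using a b U(1) le_trans by blast
      then show ?thesis using a by blast
    next
      case False
      then have "\<forall>x\<in>U. b \<preceq> x" using a b U(1) le_trans le_total by blast
      then show ?thesis using b by blast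
    qed
  qed
qed

lemma wo_on_empty [simp]: "wo_on le {}"
  by (simp add: wo_on_def)

lemma wo_on_singleton [simp]: "wo_on le {a}"
  by (auto simp: wo_on_def subset_singleton_iff)

lemma wo_on_finite_UN:
  assumes "finite I" "\<And>i. i \<in> I \<Longrightarrow> wo_on le (S i)"
  shows "wo_on le (\<Union>i\<in>I. S i)"
  using assms by (induction I rule: finite_induct) (auto intro: wo_on_Un)

text \<open>Pass to a subsequence on which the first summands are nondecreasing; a nondecreasing
  pair of second summands along it then gives a nondecreasing pair of sums.\<close>

lemma wo_on_sums:
  assumes "wo_on le S" "wo_on le T"
  shows "wo_on le {a + b |a b. a \<in> S \<and> b \<in> T}"
proof (rule wo_onI_seq)
  fix f assume "\<And>n::nat. f n \<in> {a + b |a b. a \<in> S \<and> b \<in> T}"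
  then have "\<forall>n. \<exists>a b. f n = a + b \<and> a \<in> S \<and> b \<in> T" by blast
  then obtain a b where ab: "\<And>n. f n = a n + b n" "\<And>n. a n \<in> S" "\<And>n. b n \<in> T" by metis
  obtain r :: "nat \<Rightarrow> nat" where r: "strict_mono r" "\<And>m n. m \<le> n \<Longrightarrow> a (r m) \<preceq> a (r n)"
    using wo_on_subseq[of S a] assms(1) ab(2) by metis
  obtain i j where "i < j" "b (r i) \<preceq> b (r j)"
    using wo_on_seq_le[OF assms(2), of "\<lambda>n. b (r n)"] ab(3) by blast
  then have "r i < r j" "f (r i) \<preceq> f (r j)"
    using r(1) r(2)[of i j] by (auto simp: strict_mono_less ab(1) intro: le_add_mono)
  then show "\<exists>i j. i < j \<and> f i \<preceq> f j" by blast
qed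

text \<open>Among infinitely many decompositions of \<open>c\<close>, two would be nondecreasing in
  both components. Equality of the sums then forces equality of the components.\<close>

lemma finite_sum_decompositions:
  assumes "wo_on le S" "wo_on le T"
  shows "finite {(a, b). a \<in> S \<and> b \<in> T \<and> a + b = c}"
proof (rule ccontr)
  assume "\<not> ?thesis"
  then obtain p :: "nat \<Rightarrow> _" where p: "inj p" "range p \<subseteq> {(a, b). a \<in> S \<and> b \<in> T \<and> a + b = c}"
    using infinite_countable_subset by blast
  have pS: "fst (p n) \<in> S" and pT: "snd (p n) \<in> T" and pc: "fst (p n) + snd (p n) = c" for n
  proof -
    have "p n \<in> {(a, b). a \<in> S \<and> b \<in> T \<and> a + b = c}" using p(2) rangeI[of p n] by (rule subsetD)
    then show "fst (p n) \<in> S" "snd (p n) \<in> T" "fst (p n) + snd (p n) = c"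
      by (simp_all add: case_prod_beta)
  qed
  obtain r :: "nat \<Rightarrow> nat" where r: "strict_mono r" "\<And>m n. m \<le> n \<Longrightarrow> fst (p (r m)) \<preceq> fst (p (r n))"
    using wo_on_subseq[of S "\<lambda>n. fst (p n)"] assms(1) pS by metis
  obtain i j where ij: "i < j" "snd (p (r i)) \<preceq> snd (p (r j))"
    using wo_on_seq_le[OF assms(2), of "\<lambda>n. snd (p (r n))"] pT by blast
  have "fst (p (r i)) + snd (p (r i)) \<preceq> fst (p (r i)) + snd (p (r j))" using ij(2) by simp
  moreover have "fst (p (r i)) + snd (p (r j)) \<preceq> fst (p (r j)) + snd (p (r j))"
    using r(2)[of i j] ij(1) by (simp add: le_add_right)
  ultimately have "fst (p (r i)) + snd (p (r j)) = c" using pc le_antisym by metis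
  then have "p (r i) = p (r j)" using pc[of "r i"] pc[of "r j"]
    by (metis add_left_cancel add_right_cancel prod_eqI)
  then have "r i = r j" using p(1) by (simp add: inj_def)
  then show False using r(1) ij(1) by (simp add: strict_mono_eq)
qed

text \<open>A bad sequence of words would refute both halves of Neumann's lemma. Removing the
  first letters along a subsequence on which they are nondecreasing keeps a sequence bad, which
  contradicts the minimality of a bad sequence with lexicographically minimal lengths.\<close>

definition bad_words :: "'a set \<Rightarrow> (nat \<Rightarrow> 'a list) \<Rightarrow> bool" where
  "bad_words E w \<longleftrightarrow> (\<forall>i. set (w i) \<subseteq> E) \<and>
     (\<forall>i j. i < j \<longrightarrow> sum_list (w j) \<preceq> sum_list (w i) \<and> w i \<noteq> w j)"

text \<open>The lengths are minimised one index at a time, among the bad sequences that agree with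
  the words fixed so far; \<open>w\<close> is the diagonal of the resulting sequences.\<close>

lemma minimal_bad_words:
  assumes "bad_words E w0"
  obtains w where "bad_words E w"
    "\<And>v n. bad_words E v \<Longrightarrow> (\<forall>m<n. v m = w m) \<Longrightarrow> length (w n) \<le> length (v n)"
proof -
  define P where "P n f \<longleftrightarrow> bad_words E f \<and>
    (\<forall>v. bad_words E v \<longrightarrow> (\<forall>m<n. v m = f m) \<longrightarrow> length (f n) \<le> length (v n))" for n :: nat and f
  have ex: "\<exists>g. P n g \<and> (\<forall>m<n. g m = f m)" if "bad_words E f" for n f
  proof -
    define Q where "Q g \<longleftrightarrow> bad_words E g \<and> (\<forall>m<n. g m = f m)" for g
    have "Q f" using that by (simp add: Q_def)
    then obtain g where "Q g" "\<And>h. Q h \<Longrightarrow> length (g n) \<le> length (h n)"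
      using ex_has_least_nat[of Q f "\<lambda>g. length (g n)"] by blast
    then show ?thesis unfolding Q_def P_def by (intro exI[of _ g]) auto
  qed
  have "\<exists>f. \<forall>n. P n (f n) \<and> (\<forall>m<Suc n. f (Suc n) m = f n m)"
  proof (rule dependent_nat_choice)
    show "\<exists>f. P 0 f" using ex[OF assms] by blast
    show "\<exists>g. P (Suc n) g \<and> (\<forall>m<Suc n. g m = f m)" if "P n f" for f n
      using ex[of f "Suc n"] that by (simp add: P_def)
  qed
  then obtain f where f: "\<And>n. P n (f n)" "\<And>n m. m \<le> n \<Longrightarrow> f (Suc n) m = f n m"
    by (auto simp: less_Suc_eq_le)
  have agree: "f n m = f m m" if "m \<le> n" for m n
    using that
  proof (induction n rule: dec_induct)
    case (step k)
    then show ?case using f(2)[of m k] by simp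
  qed simp
  define w where "w n = f n n" for n
  \<comment> \<open>Badness constrains only two indices at a time, and for \<open>i < j\<close> both
    words already occur in the sequence \<open>f j\<close>.\<close>
  have bad: "bad_words E w"
    unfolding bad_words_def
  proof (intro conjI allI impI)
    show "set (w i) \<subseteq> E" for i using f(1)[of i] by (simp add: P_def bad_words_def w_def)
    fix i j :: nat assume "i < j"
    moreover have "w i = f j i" using agree[of i j] \<open>i < j\<close> by (simp add: w_def)
    ultimately show "sum_list (w j) \<preceq> sum_list (w i)" "w i \<noteq> w j"
      using f(1)[of j] by (simp_all add: P_def bad_words_def w_def)
  qed
  have "length (w n) \<le> length (v n)" if "bad_words E v" "\<forall>m<n. v m = w m" for v n
  proof -
    have "\<forall>m<n. v m = f n m" using that(2) agree[of _ n] by (auto simp: w_def)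
    then show ?thesis using f(1)[of n] that(1) by (simp add: P_def w_def)
  qed
  with bad that show ?thesis by blast
qed

lemma sum_list_nonneg:
  assumes "\<And>e. e \<in> E \<Longrightarrow> 0 \<preceq> e" "set w \<subseteq> E"
  shows "0 \<preceq> sum_list w"
  using assms(2) by (induction w) (auto intro: le_add_mono[of 0 _ 0, simplified] assms(1))

lemma no_bad_words:
  assumes E: "wo_on le E" "\<And>e. e \<in> E \<Longrightarrow> 0 \<preceq> e" "0 \<notin> E"
  shows "\<not> bad_words E w"
proof
  assume "bad_words E w"
  then obtain w where bad: "bad_words E w" and
    min: "\<And>v n. bad_words E v \<Longrightarrow> (\<forall>m<n. v m = w m) \<Longrightarrow> length (w n) \<le> length (v n)"
    using minimal_bad_words by blast
  have wE: "set (w i) \<subseteq> E" for i using bad by (simp add: bad_words_def)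
  have desc: "sum_list (w j) \<preceq> sum_list (w i)" and neq: "w i \<noteq> w j" if "i < j" for i j
    using bad that by (auto simp: bad_words_def)
  \<comment> \<open>After an empty word the next one would be nonempty with sum at most
    \<open>0\<close>, although its letters are strictly positive.\<close>
  have ne: "w i \<noteq> []" for i
  proof
    assume i: "w i = []"
    have "w (Suc i) \<noteq> []" using neq[of i "Suc i"] i by auto
    then obtain x v where xv: "w (Suc i) = x # v" by (cases "w (Suc i)") auto
    have xE: "x \<in> E" and vE: "set v \<subseteq> E" using wE[of "Suc i"] xv by auto
    have v0: "0 \<preceq> sum_list v" using sum_list_nonneg[OF E(2) vE] .
    have "x + sum_list v \<preceq> 0" using desc[of i "Suc i"] i xv by simp
    moreover have "x \<preceq> x + sum_list v" using le_add_left[OF v0, of x] by simp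
    ultimately have "x \<preceq> 0" using le_trans by blast
    then have "x = 0" using le_antisym E(2)[OF xE] by blast
    then show False using E(3) xE by simp
  qed
  define x where "x i = hd (w i)" for i
  define v where "v i = tl (w i)" for i
  have wxv: "w i = x i # v i" for i using ne by (simp add: x_def v_def)
  have xE: "x i \<in> E" and vE: "set (v i) \<subseteq> E" for i using wE[of i] by (simp_all add: wxv)
  obtain r :: "nat \<Rightarrow> nat" where r: "strict_mono r" "\<And>m n. m \<le> n \<Longrightarrow> x (r m) \<preceq> x (r n)"
    using wo_on_subseq[of E x] E(1) xE by metis
  have vw: "sum_list (v i) \<preceq> sum_list (w i)" and vw_neq: "sum_list (v i) \<noteq> sum_list (w i)" for i
    using E(2)[OF xE[of i]] le_add_right[of 0 "x i" "sum_list (v i)"] E(3) xE[of i]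
    by (auto simp: wxv)
  \<comment> \<open>The words before position \<open>r 0\<close> are kept; from there on the tails
    of the words along \<open>r\<close> are used.\<close>
  define u where "u n = (if n < r 0 then w n else v (r (n - r 0)))" for n
  have u_desc: "sum_list (u j) \<preceq> sum_list (u i) \<and> u i \<noteq> u j" if ij: "i < j" for i j
  proof -
    consider "j < r 0" | "i < r 0" "r 0 \<le> j" | "r 0 \<le> i" by linarith
    then show ?thesis
    proof cases
      case 1
      then show ?thesis using ij desc neq by (simp add: u_def)
    next
      case 2
      let ?k = "r (j - r 0)"
      have "r 0 \<le> ?k" using r(1) by (simp add: strict_mono_less_eq)
      then have "i < ?k" using 2 by simp
      then have "sum_list (w ?k) \<preceq> sum_list (w i)" using desc by blast
      \<comment> \<open>Removing a positive letter lowers the sum strictly, so here the words differ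
        because their sums do.\<close>
      then have "sum_list (v ?k) \<preceq> sum_list (w i)" "sum_list (v ?k) \<noteq> sum_list (w i)"
        using vw vw_neq le_trans le_antisym by metis+
      then show ?thesis using 2 by (auto simp: u_def)
    next
      case 3
      let ?p = "r (i - r 0)" and ?q = "r (j - r 0)"
      have pq: "?p < ?q" using r(1) 3 ij by (simp add: strict_mono_less)
      have x: "x ?p \<preceq> x ?q" using r(2) 3 ij by simp
      have s: "x ?q + sum_list (v ?q) \<preceq> x ?p + sum_list (v ?p)"
        using desc[OF pq] by (simp add: wxv)
      have "x ?p + sum_list (v ?q) \<preceq> x ?q + sum_list (v ?q)" using x by (rule le_add_right)
      then have "x ?p + sum_list (v ?q) \<preceq> x ?p + sum_list (v ?p)" using s le_trans by blast
      then have 1: "sum_list (v ?q) \<preceq> sum_list (v ?p)" by simp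
      have "v ?p \<noteq> v ?q"
      proof
        assume eq: "v ?p = v ?q"
        have "x ?q \<preceq> x ?p" using s eq by simp
        then have "x ?p = x ?q" using x le_antisym by blast
        then show False using neq[OF pq] eq by (simp add: wxv)
      qed
      then show ?thesis using 1 3 ij by (simp add: u_def)
    qed
  qed
  have "bad_words E u"
    unfolding bad_words_def using u_desc wE vE by (auto simp: u_def)
  \<comment> \<open>Contradiction with minimality: \<open>u\<close> agrees with \<open>w\<close>
    before \<open>r 0\<close>, and its word there is one letter shorter.\<close>
  then have "length (w (r 0)) \<le> length (u (r 0))" by (rule min) (simp add: u_def)
  then show False by (simp add: u_def wxv)
qed

text \<open>Words representing a sequence without nondecreasing pair form a bad sequence.\<close>

theorem neumann_wo_on:
  assumes "wo_on le E" "\<And>e. e \<in> E \<Longrightarrow> 0 \<preceq> e" "0 \<notin> E"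
  shows "wo_on le (sum_list ` {w. set w \<subseteq> E})"
proof (rule wo_onI_seq, rule ccontr)
  fix f assume f: "\<And>n::nat. f n \<in> sum_list ` {w. set w \<subseteq> E}"
    and *: "\<not> (\<exists>i j. i < j \<and> f i \<preceq> f j)"
  have "\<exists>w. set w \<subseteq> E \<and> sum_list w = f n" for n using f[of n] by force
  then obtain w where w: "\<And>n. set (w n) \<subseteq> E" "\<And>n. sum_list (w n) = f n" by metis
  have "bad_words E w"
    unfolding bad_words_def
  proof (intro conjI allI impI)
    fix i j :: nat assume "i < j"
    then have "\<not> f i \<preceq> f j" using * by blast
    then show "sum_list (w j) \<preceq> sum_list (w i)" "w i \<noteq> w j"
      using w(2)[of i] w(2)[of j] le_total[of "f i" "f j"] by auto
  qed (rule w(1))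
  then show False using no_bad_words[OF assms] by blast
qed

text \<open>Infinitely many distinct words with equal sums also form a bad sequence, because
  \<open>bad_words\<close> asks for weak descent and distinctness only.\<close>

theorem neumann_finite:
  assumes "wo_on le E" "\<And>e. e \<in> E \<Longrightarrow> 0 \<preceq> e" "0 \<notin> E"
  shows "finite {w. set w \<subseteq> E \<and> sum_list w = a}"
proof (rule ccontr)
  assume "\<not> ?thesis"
  then obtain w :: "nat \<Rightarrow> _" where w: "inj w" "range w \<subseteq> {w. set w \<subseteq> E \<and> sum_list w = a}"
    using infinite_countable_subset by blast
  then have "set (w i) \<subseteq> E" "sum_list (w i) = a" for i by blast+
  then have "bad_words E w"
    unfolding bad_words_def using w(1) by (auto simp: inj_def)
  then show False using no_bad_words[OF assms] by blast
qed

end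

section \<open>The ring of Hahn series\<close>

text \<open>Away from total orders the supports are restricted to \<open>{0}\<close>, so that for every
  relation the series with admissible support form a nontrivial ring.\<close>

definition good_support :: "('a::ab_group_add \<Rightarrow> 'a \<Rightarrow> bool) \<Rightarrow> 'a set \<Rightarrow> bool" where
  "good_support le S \<longleftrightarrow> (if toa le then wo_on le S else S \<subseteq> {0})"

lemma good_support_iff: "toa le \<Longrightarrow> good_support le S \<longleftrightarrow> wo_on le S"
  by (simp add: good_support_def)

lemma good_support_subset: "good_support le S \<Longrightarrow> T \<subseteq> S \<Longrightarrow> good_support le T"
  unfolding good_support_def by (meson subset_trans toa_group.intro toa_group.wo_on_subset)

lemma good_support_empty [simp]: "good_support le {}"
  by (simp add: good_support_def toa_group.intro toa_group.wo_on_empty)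

lemma good_support_zero [simp]: "good_support le {0}"
  by (simp add: good_support_def toa_group.intro toa_group.wo_on_singleton)

lemma good_support_Un: "good_support le S \<Longrightarrow> good_support le T \<Longrightarrow> good_support le (S \<union> T)"
  unfolding good_support_def by (auto simp: toa_group.intro toa_group.wo_on_Un)

lemma good_support_sums:
  assumes "good_support le S" "good_support le T"
  shows "good_support le {a + b |a b. a \<in> S \<and> b \<in> T}"
proof (cases "toa le")
  case True
  then show ?thesis using assms toa_group.wo_on_sums[OF toa_group.intro[OF True]]
    by (simp add: good_support_iff)
next
  case False
  then show ?thesis using assms by (fastforce simp: good_support_def)
qed

lemma good_support_finite:
  assumes "good_support le S" "good_support le T"
  shows "finite {a \<in> S. c - a \<in> T}"
proof (cases "toa le")
  case True
  interpret toa_group le by unfold_locales (rule True)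
  have "finite {(a, b). a \<in> S \<and> b \<in> T \<and> a + b = c}"
    using assms True finite_sum_decompositions by (simp add: good_support_iff)
  then have "finite (fst ` {(a, b). a \<in> S \<and> b \<in> T \<and> a + b = c})" by (rule finite_imageI)
  then show ?thesis by (rule finite_subset[rotated]) force
next
  case False
  then have "{a \<in> S. c - a \<in> T} \<subseteq> {0}" using assms by (auto simp: good_support_def)
  then show ?thesis using finite_subset by blast
qed

lemma hmul_eq_sum:
  fixes f g :: "'a::ab_group_add \<Rightarrow> 'k::comm_ring_1"
  assumes "finite A" "{a. f a \<noteq> 0 \<and> g (c - a) \<noteq> 0} \<subseteq> A"
  shows "hmul f g c = (\<Sum>a\<in>A. f a * g (c - a))"
proof -
  have "hmul f g c = (\<Sum>a\<in>{a. f a \<noteq> 0 \<and> g (c - a) \<noteq> 0}. f a * g (c - a))"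
    unfolding hmul_def
    by (rule sum.reindex_bij_witness[where i = "\<lambda>a. (a, c - a)" and j = fst])
      (auto simp: algebra_simps)
  also have "\<dots> = (\<Sum>a\<in>A. f a * g (c - a))"
    by (rule sum.mono_neutral_left) (use assms in auto)
  finally show ?thesis .
qed

lemma hmul_eq_sum_good:
  fixes f g :: "'a::ab_group_add \<Rightarrow> 'k::comm_ring_1"
  assumes "good_support le S" "good_support le T" "hsupp f \<subseteq> S" "hsupp g \<subseteq> T"
  shows "hmul f g c = (\<Sum>a\<in>{a \<in> S. c - a \<in> T}. f a * g (c - a))"
  by (rule hmul_eq_sum) (use good_support_finite[OF assms(1,2)] assms(3,4) in \<open>auto simp: hsupp_def\<close>)

lemma hsupp_hmul:
  fixes f g :: "'a::ab_group_add \<Rightarrow> 'k::comm_ring_1"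
  shows "hsupp (hmul f g) \<subseteq> {a + b |a b. a \<in> hsupp f \<and> b \<in> hsupp g}"
proof
  fix c assume "c \<in> hsupp (hmul f g)"
  then have "hmul f g c \<noteq> 0" by (simp add: hsupp_def)
  then have "{(a, b). a + b = c \<and> f a \<noteq> 0 \<and> g b \<noteq> 0} \<noteq> {}"
    unfolding hmul_def by (metis (no_types, lifting) sum.empty)
  then show "c \<in> {a + b |a b. a \<in> hsupp f \<and> b \<in> hsupp g}" by (auto simp: hsupp_def)
qed

lemma hsupp_hmulE:
  fixes f g :: "'a::ab_group_add \<Rightarrow> 'k::comm_ring_1"
  assumes "c \<in> hsupp (hmul f g)"
  obtains a b where "c = a + b" "a \<in> hsupp f" "b \<in> hsupp g"
  using assms hsupp_hmul[of f g] by blast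

lemma good_support_hmul:
  fixes f g :: "'a::ab_group_add \<Rightarrow> 'k::comm_ring_1"
  assumes "good_support le (hsupp f)" "good_support le (hsupp g)"
  shows "good_support le (hsupp (hmul f g))"
  using good_support_subset[OF good_support_sums[OF assms] hsupp_hmul] .

lemma hmul_commute:
  fixes f g :: "'a::ab_group_add \<Rightarrow> 'k::comm_ring_1"
  shows "hmul f g = hmul g f"
proof
  fix c
  show "hmul f g c = hmul g f c"
    unfolding hmul_def
    by (rule sum.reindex_bij_witness[where i = prod.swap and j = prod.swap])
      (auto simp: add.commute mult.commute)
qed

text \<open>Both sides are one sum over triples of exponents. The outer sums run over sumsets of
  supports instead of the support of the inner product, which cancellation could make
  smaller.\<close>

lemma hmul_assoc:
  fixes f g h :: "'a::ab_group_add \<Rightarrow> 'k::comm_ring_1"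
  assumes "good_support le (hsupp f)" "good_support le (hsupp g)" "good_support le (hsupp h)"
  shows "hmul (hmul f g) h = hmul f (hmul g h)"
proof
  fix c
  let ?S = "hsupp f" and ?T = "hsupp g" and ?U = "hsupp h"
  let ?ST = "{a + b |a b. a \<in> ?S \<and> b \<in> ?T}" and ?TU = "{a + b |a b. a \<in> ?T \<and> b \<in> ?U}"
  let ?B = "{b \<in> ?ST. c - b \<in> ?U}" and ?A = "{a \<in> ?S. c - a \<in> ?TU}"
  note fin = good_support_finite[OF good_support_sums[OF assms(1,2)] assms(3)]
    good_support_finite[OF assms(1) good_support_sums[OF assms(2,3)]]
    good_support_finite[OF assms(1,2)] good_support_finite[OF assms(2,3)]
  have "hmul (hmul f g) h c = (\<Sum>b\<in>?B. hmul f g b * h (c - b))"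
    by (rule hmul_eq_sum_good[OF good_support_sums[OF assms(1,2)] assms(3) hsupp_hmul subset_refl])
  also have "\<dots> = (\<Sum>b\<in>?B. \<Sum>a\<in>{a \<in> ?S. b - a \<in> ?T}. f a * g (b - a) * h (c - b))"
    by (simp add: hmul_eq_sum_good[OF assms(1,2) subset_refl subset_refl] sum_distrib_right)
  also have "\<dots> = (\<Sum>(b, a)\<in>Sigma ?B (\<lambda>b. {a \<in> ?S. b - a \<in> ?T}). f a * g (b - a) * h (c - b))"
    by (rule sum.Sigma) (use fin in auto)
  \<comment> \<open>Before the exchange \<open>b\<close> is the sum of the first two exponents,
    afterwards it is the middle exponent.\<close>
  also have "\<dots> = (\<Sum>(a, b)\<in>Sigma ?A (\<lambda>a. {b \<in> ?T. c - a - b \<in> ?U}). f a * (g b * h (c - a - b)))"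
    by (rule sum.reindex_bij_witness[where i = "\<lambda>(a, b). (a + b, a)" and j = "\<lambda>(b, a). (a, b - a)"])
      (auto simp: mult.assoc diff_diff_eq, (metis add_diff_cancel_left' diff_add_cancel diff_diff_eq2 add.commute diff_diff_add)+)
  also have "\<dots> = (\<Sum>a\<in>?A. \<Sum>b\<in>{b \<in> ?T. c - a - b \<in> ?U}. f a * (g b * h (c - a - b)))"
    by (rule sum.Sigma[symmetric]) (use fin in auto)
  also have "\<dots> = (\<Sum>a\<in>?A. f a * hmul g h (c - a))"
    by (simp add: hmul_eq_sum_good[OF assms(2,3) subset_refl subset_refl] sum_distrib_left)
  also have "\<dots> = hmul f (hmul g h) c"
    by (rule hmul_eq_sum_good[OF assms(1) good_support_sums[OF assms(2,3)] subset_refl hsupp_hmul, symmetric])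
  finally show "hmul (hmul f g) h c = hmul f (hmul g h) c" .
qed

lemma hsupp_add: "hsupp (\<lambda>a. f a + g a :: 'k::monoid_add) \<subseteq> hsupp f \<union> hsupp g"
  by (auto simp: hsupp_def)

lemma hmul_add_left:
  fixes f g h :: "'a::ab_group_add \<Rightarrow> 'k::comm_ring_1"
  assumes "good_support le (hsupp f)" "good_support le (hsupp g)" "good_support le (hsupp h)"
  shows "hmul (\<lambda>a. f a + g a) h = (\<lambda>a. hmul f h a + hmul g h a)"
proof
  fix c
  note S = good_support_Un[OF assms(1,2)]
  show "hmul (\<lambda>a. f a + g a) h c = hmul f h c + hmul g h c"
    unfolding hmul_eq_sum_good[OF S assms(3) hsupp_add subset_refl]
      hmul_eq_sum_good[OF S assms(3) Un_upper1 subset_refl]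
      hmul_eq_sum_good[OF S assms(3) Un_upper2 subset_refl]
    by (simp add: distrib_right sum.distrib)
qed

lemma hmul_hone_left [simp]: "hmul hone f = (f :: 'a::ab_group_add \<Rightarrow> 'k::comm_ring_1)"
proof
  fix c
  show "hmul hone f c = f c"
    by (subst hmul_eq_sum[of "{0}"]) (auto simp: hone_def)
qed

lemma hmul_hone_right [simp]: "hmul f hone = (f :: 'a::ab_group_add \<Rightarrow> 'k::comm_ring_1)"
  by (subst hmul_commute) simp

lemma hsupp_hone_subset: "hsupp (hone :: 'a::zero \<Rightarrow> 'k::{zero,one}) \<subseteq> {0}"
  by (auto simp: hsupp_def hone_def)

lemma good_support_hone [simp]: "good_support le (hsupp (hone :: _ \<Rightarrow> 'k::{zero,one}))"
  using good_support_subset[OF good_support_zero hsupp_hone_subset] .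

text \<open>The order is a term and cannot index a type. The product over all relations of the
  corresponding rings of Hahn series is a type, however, so that determinants are available.\<close>

typedef (overloaded) ('a, 'k) hfam =
  "{X :: ('a::ab_group_add \<Rightarrow> 'a \<Rightarrow> bool) \<Rightarrow> 'a \<Rightarrow> 'k::comm_ring_1. \<forall>le. good_support le (hsupp (X le))}"
  morphisms proj Abs_hfam
  by (rule exI[of _ "\<lambda>_ _. 0"]) (simp add: hsupp_def)

setup_lifting type_definition_hfam

instantiation hfam :: (ab_group_add, comm_ring_1) comm_ring_1
begin

lift_definition zero_hfam :: "('a, 'b) hfam" is "\<lambda>_ _. 0"
  by (simp add: hsupp_def)

lift_definition one_hfam :: "('a, 'b) hfam" is "\<lambda>_. hone"
  by simp

lift_definition plus_hfam :: "('a, 'b) hfam \<Rightarrow> ('a, 'b) hfam \<Rightarrow> ('a, 'b) hfam"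
  is "\<lambda>X Y le a. X le a + Y le a"
  using good_support_subset[OF good_support_Un hsupp_add] by blast

lift_definition uminus_hfam :: "('a, 'b) hfam \<Rightarrow> ('a, 'b) hfam" is "\<lambda>X le a. - X le a"
  by (simp add: hsupp_def)

definition minus_hfam :: "('a, 'b) hfam \<Rightarrow> ('a, 'b) hfam \<Rightarrow> ('a, 'b) hfam" where
  "minus_hfam X Y = X + - Y"

lift_definition times_hfam :: "('a, 'b) hfam \<Rightarrow> ('a, 'b) hfam \<Rightarrow> ('a, 'b) hfam"
  is "\<lambda>X Y le. hmul (X le) (Y le)"
  using good_support_hmul by blast

instance
proof
  fix X Y Z :: "('a, 'b) hfam"
  show "X * Y * Z = X * (Y * Z)" by transfer (auto intro!: ext fun_cong[OF hmul_assoc])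
  show "X * Y = Y * X" by transfer (rule ext, rule hmul_commute)
  show "1 * X = X" by transfer simp
  show "(X + Y) * Z = X * Z + Y * Z" by transfer (auto intro!: ext fun_cong[OF hmul_add_left])
  show "X + Y + Z = X + (Y + Z)" by transfer (simp add: add.assoc)
  show "X + Y = Y + X" by transfer (simp add: add.commute)
  show "0 + X = X" by transfer simp
  show "- X + X = 0" by transfer simp
  show "X - Y = X + - Y" by (rule minus_hfam_def)
  show "(0 :: ('a, 'b) hfam) \<noteq> 1" by transfer (auto simp: hone_def fun_eq_iff)
qed

end

lemma proj_0 [simp]: "proj 0 le = (\<lambda>_. 0)" by transfer simp
lemma proj_1 [simp]: "proj 1 le = hone" by transfer simp
lemma proj_add [simp]: "proj (X + Y) le a = proj X le a + proj Y le a" by transfer simp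
lemma proj_minus [simp]: "proj (- X) le a = - proj X le a" by transfer simp
lemma proj_diff [simp]: "proj (X - Y) le a = proj X le a - proj Y le a"
  unfolding minus_hfam_def by (simp del: add_uminus_conv_diff add: diff_conv_add_uminus)
lemma proj_mult: "proj (X * Y) le = hmul (proj X le) (proj Y le)" by transfer simp

lemma proj_sum: "proj (\<Sum>i\<in>I. X i) le a = (\<Sum>i\<in>I. proj (X i) le a)"
  by (induction I rule: infinite_finite_induct) simp_all

lemma good_support_proj [simp]: "good_support le (hsupp (proj X le))"
  by transfer simp

lemma hfam_eqI: "(\<And>le a. proj X le a = proj Y le a) \<Longrightarrow> X = Y"
  by transfer (simp add: fun_eq_iff)

text \<open>The default is \<open>hone\<close> and not \<open>0\<close>, so that a product which
  equals \<open>1\<close> at \<open>le\<close> equals \<open>1\<close> in the whole family.\<close>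

lift_definition at_order :: "('a::ab_group_add \<Rightarrow> 'a \<Rightarrow> bool) \<Rightarrow> ('a \<Rightarrow> 'k::comm_ring_1) \<Rightarrow> ('a, 'k) hfam"
  is "\<lambda>le f le'. if le' = le \<and> good_support le (hsupp f) then f else hone"
  by simp

lemma proj_at_order: "good_support le (hsupp f) \<Longrightarrow> proj (at_order le f) le = f"
  by transfer simp

lemma proj_at_order_other: "le' \<noteq> le \<Longrightarrow> proj (at_order le f) le' = hone"
  by transfer simp

text \<open>For additive \<open>d\<close> this is a derivation; with \<open>d\<close> the exponent
  of a variable it is the Euler operator of that variable.\<close>

lift_definition hderiv :: "('a::ab_group_add \<Rightarrow> int) \<Rightarrow> ('a, 'k::comm_ring_1) hfam \<Rightarrow> ('a, 'k) hfam"
  is "\<lambda>d X le a. of_int (d a) * X le a"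
  subgoal for d X le
    by (rule good_support_subset[of le "hsupp (X le)"]) (simp, auto simp: hsupp_def)
  done

lemma proj_hderiv [simp]: "proj (hderiv d X) le a = of_int (d a) * proj X le a"
  by transfer simp

lemma hderiv_add: "hderiv d (X + Y) = hderiv d X + hderiv d Y"
  by (rule hfam_eqI) (simp add: distrib_left)

lemma hderiv_mult:
  assumes "\<And>a b. d (a + b) = d a + d b"
  shows "hderiv d (X * Y) = hderiv d X * Y + X * hderiv d Y"
proof (rule hfam_eqI)
  fix le c
  let ?S = "hsupp (proj X le)" and ?T = "hsupp (proj Y le)"
  have sub: "hsupp (proj (hderiv d X) le) \<subseteq> ?S" "hsupp (proj (hderiv d Y) le) \<subseteq> ?T"
    by (auto simp: hsupp_def)
  note eq = hmul_eq_sum_good[of le ?S ?T, OF good_support_proj good_support_proj]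
  have d: "d c = d a + d (c - a)" for a using assms[of a "c - a"] by simp
  have "of_int (d c) * (proj X le a * proj Y le (c - a)) =
      proj (hderiv d X) le a * proj Y le (c - a) + proj X le a * proj (hderiv d Y) le (c - a)" for a
    by (simp add: d[of a] algebra_simps)
  then show "proj (hderiv d (X * Y)) le c = proj (hderiv d X * Y + X * hderiv d Y) le c"
    by (simp only: proj_hderiv proj_add proj_mult eq[OF subset_refl subset_refl] eq[OF sub(1) subset_refl]
        eq[OF subset_refl sub(2)] sum_distrib_left sum.distrib)
qed

lemma hderiv_commute: "hderiv d (hderiv d' X) = hderiv d' (hderiv d X)"
  by (rule hfam_eqI) (simp add: mult_ac)

section \<open>A torsion-free cover of the coefficient field\<close>

text \<open>The multiplicative monoid of the field, written additively because the convolution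
  product of \<open>poly_mapping\<close> adds exponents.\<close>

typedef 'k mult_monoid = "UNIV :: 'k set"
  by simp

setup_lifting type_definition_mult_monoid

instantiation mult_monoid :: (comm_monoid_mult) comm_monoid_add
begin
lift_definition zero_mult_monoid :: "'a mult_monoid" is 1 .
lift_definition plus_mult_monoid :: "'a mult_monoid \<Rightarrow> 'a mult_monoid \<Rightarrow> 'a mult_monoid" is "(*)" .
instance by standard (transfer; simp add: mult_ac)+
end

lemma Rep_mult_monoid_zero [simp]: "Rep_mult_monoid 0 = 1" by transfer simp
lemma Rep_mult_monoid_add [simp]: "Rep_mult_monoid (x + y) = Rep_mult_monoid x * Rep_mult_monoid y"
  by transfer simp

type_synonym 'k cover = "'k mult_monoid \<Rightarrow>\<^sub>0 int"

definition cover_map :: "'k::field cover \<Rightarrow> 'k" where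
  "cover_map p = (\<Sum>m\<in>Poly_Mapping.keys p. of_int (Poly_Mapping.lookup p m) * Rep_mult_monoid m)"

text \<open>A section of \<open>cover_map\<close> that is not additive. Zero goes to the zero of the
  ring, not to the basis element of the monoid element 0, so that lifting a series preserves its
  support.\<close>

definition cover_lift :: "'k::field \<Rightarrow> 'k cover" where
  "cover_lift c = (if c = 0 then 0 else Poly_Mapping.single (Abs_mult_monoid c) 1)"

lemma cover_map_superset:
  assumes "finite S" "Poly_Mapping.keys p \<subseteq> S"
  shows "cover_map p = (\<Sum>m\<in>S. of_int (Poly_Mapping.lookup p m) * Rep_mult_monoid m)"
  unfolding cover_map_def by (rule sum.mono_neutral_left) (use assms in \<open>auto simp: in_keys_iff\<close>)

lemma cover_map_0 [simp]: "cover_map 0 = 0"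
  by (simp add: cover_map_def)

lemma cover_map_single [simp]:
  "cover_map (Poly_Mapping.single m c) = of_int c * Rep_mult_monoid m"
  by (subst cover_map_superset[of "{m}"]) auto

lemma cover_map_1 [simp]: "cover_map 1 = 1"
  using cover_map_single[of 0 1] by (simp del: cover_map_single)

lemma cover_map_add: "cover_map (p + q) = cover_map p + cover_map q"
proof -
  let ?S = "Poly_Mapping.keys p \<union> Poly_Mapping.keys q"
  have "Poly_Mapping.keys (p + q) \<subseteq> ?S" by (rule Poly_Mapping.keys_add)
  then show ?thesis
    by (simp add: cover_map_superset[of ?S] lookup_add distrib_right sum.distrib)
qed

lemma cover_map_sum: "cover_map (\<Sum>i\<in>I. f i) = (\<Sum>i\<in>I. cover_map (f i))"
  by (induction I rule: infinite_finite_induct) (simp_all add: cover_map_add)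

lemma cover_sum_single:
  "(\<Sum>m\<in>Poly_Mapping.keys p. Poly_Mapping.single m (Poly_Mapping.lookup p m)) = p"
  by (rule poly_mapping_eqI) (simp add: lookup_sum lookup_single when_def in_keys_iff)

lemma cover_map_mult: "cover_map (p * q) = cover_map p * cover_map q"
proof -
  have "p * q = (\<Sum>m\<in>Poly_Mapping.keys p. Poly_Mapping.single m (Poly_Mapping.lookup p m)) *
      (\<Sum>m\<in>Poly_Mapping.keys q. Poly_Mapping.single m (Poly_Mapping.lookup q m))"
    by (simp only: cover_sum_single)
  also have "\<dots> = (\<Sum>m\<in>Poly_Mapping.keys p. \<Sum>n\<in>Poly_Mapping.keys q.
      Poly_Mapping.single (m + n) (Poly_Mapping.lookup p m * Poly_Mapping.lookup q n))"
    by (simp add: sum_product mult_single)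
  finally show ?thesis
    by (simp add: cover_map_sum cover_map_def[of p] cover_map_def[of q] sum_product mult_ac)
qed

lemma cover_of_int: "of_int k = (Poly_Mapping.single 0 k :: 'k::field cover)"
  by (metis of_int_eq_id id_apply single_of_int)

lemma cover_map_of_int [simp]: "cover_map (of_int k) = of_int k"
  by (simp add: cover_of_int)

lemma cover_map_lift [simp]: "cover_map (cover_lift c) = c"
  by (simp add: cover_lift_def Abs_mult_monoid_inverse)

lemma cover_lift_eq_0_iff [simp]: "cover_lift c = 0 \<longleftrightarrow> c = 0"
  using cover_map_lift[of c] by (auto simp: cover_lift_def simp del: cover_map_lift)

lemma cover_lift_inverse:
  assumes "c \<noteq> 0"
  shows "cover_lift c * cover_lift (inverse c) = 1"
proof -
  have "Abs_mult_monoid c + Abs_mult_monoid (inverse c) = 0"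
    using assms by (simp add: Rep_mult_monoid_inject[symmetric] Abs_mult_monoid_inverse)
  then show ?thesis using assms by (simp add: cover_lift_def mult_single)
qed

text \<open>The additive group of the cover is free abelian, whatever the characteristic of the
  field.\<close>

lemma cover_torsion_free:
  assumes "of_int k * (p :: 'k::field cover) = 0"
  shows "k = 0 \<or> p = 0"
proof (cases "k = 0")
  case False
  have "of_int k * p = Poly_Mapping.map ((*) k) p"
    by (simp add: mult_map_scale_conv_mult cover_of_int)
  moreover have "Poly_Mapping.lookup (Poly_Mapping.map ((*) k) p) m = k * Poly_Mapping.lookup p m" for m
    by (simp add: Poly_Mapping.map.rep_eq when_def)
  ultimately have "k * Poly_Mapping.lookup p m = 0" for m
    using assms lookup_zero by metis
  then have "Poly_Mapping.lookup p m = 0" for m using False by simp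
  then show ?thesis by (simp add: poly_mapping_eqI)
qed simp

definition reduce :: "('a::ab_group_add \<Rightarrow> 'a \<Rightarrow> bool) \<Rightarrow> ('a, 'k::field cover) hfam \<Rightarrow> 'a \<Rightarrow> 'k" where
  "reduce le X = (\<lambda>a. cover_map (proj X le a))"

lemma hsupp_reduce: "hsupp (reduce le X) \<subseteq> hsupp (proj X le)"
  by (auto simp: hsupp_def reduce_def)

lemma good_support_reduce [simp]: "good_support le (hsupp (reduce le X))"
  by (rule good_support_subset[OF good_support_proj hsupp_reduce])

text \<open>Reduction may kill coefficients, so both convolutions are written over the supports of
  the unreduced series.\<close>

lemma reduce_mult: "reduce le (X * Y) = hmul (reduce le X) (reduce le Y)"
proof
  fix c
  show "reduce le (X * Y) c = hmul (reduce le X) (reduce le Y) c"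
    unfolding hmul_eq_sum_good[OF good_support_proj good_support_proj hsupp_reduce hsupp_reduce]
    unfolding reduce_def proj_mult
      hmul_eq_sum_good[OF good_support_proj good_support_proj subset_refl subset_refl]
    by (simp add: cover_map_sum cover_map_mult)
qed

lemma reduce_1 [simp]: "reduce le 1 = hone"
  by (auto simp: reduce_def hone_def)

lemma reduce_sum: "reduce le (\<Sum>i\<in>I. X i) = (\<lambda>a. \<Sum>i\<in>I. reduce le (X i) a)"
  by (simp add: reduce_def proj_sum cover_map_sum)

section \<open>Residues of logarithmic Jacobians in differential rings\<close>

text \<open>Multilinearity in row \<open>i\<close>; a summand with \<open>m \<noteq> i\<close> has
  two equal rows.\<close>

lemma det_replace_row_sum:
  fixes N :: "'r::comm_ring_1^'n^'n" and k :: "'n \<Rightarrow> 'r"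
  shows "det (\<chi> l. if l = i then (\<Sum>m\<in>UNIV. k m *s N $ m) else N $ l) = k i * det N"
proof -
  have "det (\<chi> l. if l = i then (\<Sum>m\<in>UNIV. k m *s N $ m) else N $ l) =
      (\<Sum>m\<in>UNIV. det (\<chi> l. if l = i then k m *s N $ m else N $ l))"
    by (rule det_linear_row_sum) simp
  also have "\<dots> = (\<Sum>m\<in>UNIV. k m * det (\<chi> l. if l = i then N $ m else N $ l))"
    by (simp add: det_row_mul)
  also have "\<dots> = (\<Sum>m\<in>UNIV. if m = i then k i * det N else 0)"
  proof (rule sum.cong[OF refl])
    fix m :: 'n
    have "(\<chi> l. if l = i then N $ m else N $ l) = N" if "m = i" using that by (simp add: vec_eq_iff)
    moreover have "det (\<chi> l. if l = i then N $ m else N $ l) = 0" if "m \<noteq> i"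
      by (rule det_identical_rows[of i m]) (use that in \<open>auto simp: row_def\<close>)
    ultimately show "k m * det (\<chi> l. if l = i then N $ m else N $ l) = (if m = i then k i * det N else 0)"
      by (cases "m = i") (simp_all only: if_True if_False mult_zero_right not_False_eq_True simp_thms)
  qed
  finally show ?thesis by simp
qed

text \<open>The inverse \<open>y\<close> of \<open>x\<close> is passed along, since the ring is not
  a field.\<close>

definition zpow :: "'r::comm_ring_1 \<Rightarrow> 'r \<Rightarrow> int \<Rightarrow> 'r" where
  "zpow x y k = (if 0 \<le> k then x ^ nat k else y ^ nat (- k))"

lemma zpow_0 [simp]: "zpow x y 0 = 1"
  by (simp add: zpow_def)

lemma zpow_add_one:
  assumes "x * y = 1"
  shows "zpow x y (k + 1) = x * zpow x y k"
proof (cases "0 \<le> k")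
  case True
  then show ?thesis by (simp add: zpow_def nat_add_distrib)
next
  case False
  then have "nat (- k) = Suc (nat (- (k + 1)))" by simp
  then show ?thesis using False assms by (auto simp: zpow_def mult.assoc[symmetric])
qed

text \<open>\<open>D\<close> abstracts the Euler operators and \<open>L\<close> the reading of a
  coefficient at \<open>x^0\<close>. Torsion-freeness is imposed on the target of \<open>L\<close>,
  where the divisions by integers take place.\<close>

locale residue_functional =
  fixes D :: "'n::finite \<Rightarrow> 'r::comm_ring_1 \<Rightarrow> 'r" and L :: "'r \<Rightarrow> 's::ring_1"
  assumes D_add: "D j (x + y) = D j x + D j y"
    and D_mult: "D j (x * y) = D j x * y + x * D j y"
    and D_commute: "D i (D j x) = D j (D i x)"
    and L_add: "L (x + y) = L x + L y"
    and L_D: "L (D j x) = 0"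
    and torsion_free: "of_int k * (s :: 's) = 0 \<Longrightarrow> k = 0 \<or> s = 0"
begin

lemma D_one [simp]: "D j 1 = 0"
  using D_mult[of j 1 1] by simp

lemma D_prod:
  assumes "finite S"
  shows "D j (\<Prod>l\<in>S. f l) = (\<Sum>m\<in>S. D j (f m) * (\<Prod>l\<in>S - {m}. f l))"
  using assms
proof (induction S rule: finite_induct)
  case (insert a S)
  have "(\<Sum>m\<in>S. D j (f m) * (\<Prod>l\<in>insert a S - {m}. f l)) =
      (\<Sum>m\<in>S. f a * (D j (f m) * (\<Prod>l\<in>S - {m}. f l)))"
  proof (rule sum.cong[OF refl])
    fix m assume "m \<in> S"
    then have "insert a S - {m} = insert a (S - {m})" "a \<notin> S - {m}" using insert by auto
    then show "D j (f m) * (\<Prod>l\<in>insert a S - {m}. f l) = f a * (D j (f m) * (\<Prod>l\<in>S - {m}. f l))"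
      using insert(1) by (simp add: mult_ac)
  qed
  moreover have "insert a S - {a} = S" using insert by auto
  ultimately show ?case using insert by (simp add: D_mult sum_distrib_left)
qed simp

lemma L_zero [simp]: "L 0 = 0"
  using L_add[of 0 0] by simp

lemma L_minus: "L (- x) = - L x"
  using L_add[of x "- x"] by (simp add: eq_neg_iff_add_eq_0 add.commute)

lemma L_sum: "L (\<Sum>i\<in>I. f i) = (\<Sum>i\<in>I. L (f i))"
  by (induction I rule: infinite_finite_induct) (simp_all add: L_add)

lemma L_of_nat_mult: "L (of_nat m * x) = of_nat m * L x"
  by (induction m) (simp_all add: L_add distrib_right)

lemma L_of_int_mult: "L (of_int m * x) = of_int m * L x"
proof (cases m)
  case (nonneg n)
  then show ?thesis by (simp add: L_of_nat_mult)
next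
  case (neg n)
  then have "of_int m = (- of_nat (Suc n) :: 'r)" "of_int m = (- of_nat (Suc n) :: 's)" by simp_all
  then show ?thesis by (simp only: mult_minus_left L_minus L_of_nat_mult)
qed

text \<open>The row is regarded as a 1-form in the coframe dual to the commuting derivations
  \<open>D\<close>; the condition says that its exterior derivative vanishes.\<close>

definition closed_row :: "'r^'n \<Rightarrow> bool" where
  "closed_row c \<longleftrightarrow> (\<forall>j m. D j (c $ m) = D m (c $ j))"

text \<open>Stokes' theorem: the determinant is the divergence of \<open>\<psi>\<close> times its cofactors up to terms
  that cancel in pairs under transpositions, because the other rows are closed.\<close>

lemma L_det_gradient_row:
  assumes M: "\<And>l. l \<noteq> i \<Longrightarrow> closed_row (M l)"
  shows "L (det (\<chi> l. if l = i then (\<chi> j. D j \<psi>) else M l)) = 0"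
proof -
  let ?P = "{p. p permutes (UNIV :: 'n set)}"
  define \<theta> where "\<theta> p = (\<Prod>l\<in>UNIV - {i}. M l $ p l)" for p
  \<comment> \<open>The part of the Leibniz expansion of
    \<open>\<psi> * D (p i) (\<theta> p)\<close> in which the derivative falls on row
    \<open>m\<close>, with the sign of \<open>p\<close>.\<close>
  define \<tau> where "\<tau> m p = of_int (sign p) * (\<psi> * (D (p i) (M m $ p m) * (\<Prod>l\<in>UNIV - {i} - {m}. M l $ p l)))"
    for m and p :: "'n \<Rightarrow> 'n"
  have expand: "of_int (sign p) * (\<Prod>l\<in>UNIV. (\<chi> l. if l = i then (\<chi> j. D j \<psi>) else M l) $ l $ p l) =
      of_int (sign p) * D (p i) (\<psi> * \<theta> p) - (\<Sum>m\<in>UNIV - {i}. \<tau> m p)" for p :: "'n \<Rightarrow> 'n"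
  proof -
    have "(\<Prod>l\<in>UNIV. (\<chi> l. if l = i then (\<chi> j. D j \<psi>) else M l) $ l $ p l) = D (p i) \<psi> * \<theta> p"
      by (subst prod.remove[of _ i]) (auto simp: \<theta>_def intro!: prod.cong)
    moreover have "(\<Sum>m\<in>UNIV - {i}. \<tau> m p) = of_int (sign p) * (\<psi> * D (p i) (\<theta> p))"
      by (simp add: \<tau>_def \<theta>_def D_prod sum_distrib_left mult_ac)
    ultimately show ?thesis by (simp add: D_mult algebra_simps)
  qed
  \<comment> \<open>Composition with the transposition exchanges the direction of the derivative and
    the column of row \<open>m\<close>. Closedness leaves the differentiated factor unchanged, while
    the sign flips.\<close>
  have swap: "(\<Sum>p\<in>?P. \<tau> m p) = - (\<Sum>p\<in>?P. \<tau> m p)" if m: "m \<in> UNIV - {i}" for m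
  proof -
    let ?t = "Transposition.transpose i m"
    have t: "?t permutes UNIV" by (simp add: permutes_swap_id)
    have "(\<Sum>p\<in>?P. \<tau> m p) = (\<Sum>p\<in>?P. \<tau> m (p \<circ> ?t))"
      by (rule sum_permutations_compose_right[OF t])
    also have "\<dots> = (\<Sum>p\<in>?P. - \<tau> m p)"
    proof (rule sum.cong[OF refl])
      fix p assume "p \<in> ?P"
      then have "permutation p" by (auto simp: permutation_permutes)
      then have s: "sign (p \<circ> ?t) = - sign p"
        using m by (auto simp: sign_compose permutation_swap_id sign_swap_id)
      have d: "D (p m) (M m $ p i) = D (p i) (M m $ p m)"
        using M[of m] m by (auto simp: closed_row_def)
      have "(\<Prod>l\<in>UNIV - {i} - {m}. M l $ (p \<circ> ?t) l) = (\<Prod>l\<in>UNIV - {i} - {m}. M l $ p l)"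
        by (rule prod.cong) (auto simp: Transposition.transpose_def)
      then show "\<tau> m (p \<circ> ?t) = - \<tau> m p"
        using s d by (simp add: \<tau>_def)
    qed
    finally show ?thesis by (simp add: sum_negf)
  qed
  \<comment> \<open>A sum equal to its negative is only known to be killed by 2; torsion-freeness of
    the target finishes.\<close>
  have zero: "L (\<Sum>p\<in>?P. \<tau> m p) = 0" if "m \<in> UNIV - {i}" for m
  proof -
    have "L (\<Sum>p\<in>?P. \<tau> m p) = - L (\<Sum>p\<in>?P. \<tau> m p)" using swap[OF that] L_minus by metis
    then have "of_int 2 * L (\<Sum>p\<in>?P. \<tau> m p) = 0" by (simp add: eq_neg_iff_add_eq_0 mult_2)
    then show ?thesis using torsion_free by fastforce
  qed
  have "L (det (\<chi> l. if l = i then (\<chi> j. D j \<psi>) else M l)) =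
      (\<Sum>p\<in>?P. of_int (sign p) * L (D (p i) (\<psi> * \<theta> p))) - L (\<Sum>p\<in>?P. \<Sum>m\<in>UNIV - {i}. \<tau> m p)"
    unfolding det_def expand sum_subtractf using L_add[of _ "- _"]
    by (simp add: L_sum L_minus L_of_int_mult del: vec_lambda_beta)
  also have "(\<Sum>p\<in>?P. \<Sum>m\<in>UNIV - {i}. \<tau> m p) = (\<Sum>m\<in>UNIV - {i}. \<Sum>p\<in>?P. \<tau> m p)"
    by (rule sum.swap)
  also have "L \<dots> = 0"
    unfolding L_sum[of _ "UNIV - {i}"] by (rule sum.neutral) (use zero in blast)
  finally show ?thesis by (simp add: L_D)
qed

section \<open>Logarithmic derivatives\<close>

definition dlog :: "'r \<Rightarrow> 'r \<Rightarrow> 'r^'n" where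
  "dlog x y = (\<chi> j. y * D j x)"

lemma D_inverse:
  assumes "x * y = 1"
  shows "D j y = - (y * y * D j x)"
proof -
  have "D j x * y + x * D j y = 0" using D_mult[of j x y] assms by simp
  then have "y * (D j x * y + x * D j y) = 0" by simp
  then have "y * y * D j x + (x * y) * D j y = 0" by (simp add: algebra_simps)
  then show ?thesis using assms by (simp add: eq_neg_iff_add_eq_0 add.commute)
qed

text \<open>The derivative consists of a second derivative and the term
  \<open>- (y * D j x) * (y * D m x)\<close>, both symmetric in \<open>j\<close> and
  \<open>m\<close>.\<close>

lemma closed_row_dlog:
  assumes "x * y = 1"
  shows "closed_row (dlog x y)"
  unfolding closed_row_def dlog_def
proof (intro allI)
  fix j m
  have "D j (y * D m x) = D m (y * D j x)"
    unfolding D_mult D_inverse[OF assms] D_commute[of j m] by (simp add: mult_ac)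
  then show "D j ((\<chi> j. y * D j x) $ m) = D m ((\<chi> j. y * D j x) $ j)" by simp
qed

lemma closed_row_add: "closed_row a \<Longrightarrow> closed_row b \<Longrightarrow> closed_row (a + b)"
  by (simp add: closed_row_def D_add)

lemma dlog_mult:
  assumes "x * y = 1" "x' * y' = 1"
  shows "dlog (x * x') (y * y') = dlog x y + dlog x' y'"
proof -
  have "(y * y') * (D j x * x' + x * D j x') = y * D j x + y' * D j x'" for j
  proof -
    have "(y * y') * (D j x * x' + x * D j x') = y * D j x * (x' * y') + y' * D j x' * (x * y)"
      by (simp add: algebra_simps)
    then show ?thesis using assms by simp
  qed
  then show ?thesis by (simp add: vec_eq_iff dlog_def D_mult)
qed

text \<open>After cancelling \<open>D j x * zpow x y k\<close>, the formula at \<open>k + 1\<close>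
  is \<open>x\<close> times the formula at \<open>k\<close>. As \<open>x\<close> is a unit, this
  equivalence serves the induction in both directions.\<close>

lemma D_zpow:
  assumes "x * y = 1"
  shows "D j (zpow x y k) = of_int k * zpow x y k * (y * D j x)"
proof -
  have step: "D j (zpow x y (k + 1)) = of_int (k + 1) * zpow x y (k + 1) * (y * D j x) \<longleftrightarrow>
      D j (zpow x y k) = of_int k * zpow x y k * (y * D j x)" (is "?A \<longleftrightarrow> ?B") for k
  proof -
    have xy: "x * (y * z) = z" "y * (x * z) = z" for z
      using assms by (metis mult.assoc mult.commute mult_1)+
    have "?A \<longleftrightarrow> x * D j (zpow x y k) = x * (of_int k * zpow x y k * (y * D j x))"
      unfolding zpow_add_one[OF assms] by (simp add: D_mult algebra_simps xy)
    also have "\<dots> \<longleftrightarrow> ?B" using xy(2) by metis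
    finally show ?thesis .
  qed
  show ?thesis
  proof (induction k rule: int_induct[of _ 0])
    case (step1 i)
    then show ?case using step[of i] by simp
  next
    case (step2 i)
    then show ?case using step[of "i - 1"] by simp
  qed simp
qed

lemma D_prod_zpow:
  fixes F F' :: "'n \<Rightarrow> 'r"
  assumes "\<And>l. F l * F' l = 1"
  shows "D j (\<Prod>l\<in>UNIV. zpow (F l) (F' l) (k l)) =
    (\<Prod>l\<in>UNIV. zpow (F l) (F' l) (k l)) * (\<Sum>l\<in>UNIV. of_int (k l) * dlog (F l) (F' l) $ j)"
proof -
  have "D j (\<Prod>l\<in>UNIV. zpow (F l) (F' l) (k l)) = (\<Sum>m\<in>UNIV. (zpow (F m) (F' m) (k m) *
      (\<Prod>l\<in>UNIV - {m}. zpow (F l) (F' l) (k l))) * (of_int (k m) * dlog (F m) (F' m) $ j))"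
    unfolding D_prod[OF finite_class.finite_UNIV] D_zpow[OF assms] dlog_def
    by (rule sum.cong) (simp_all add: mult_ac)
  also have "\<dots> = (\<Sum>m\<in>UNIV. (\<Prod>l\<in>UNIV. zpow (F l) (F' l) (k l)) * (of_int (k m) * dlog (F m) (F' m) $ j))"
    by (intro sum.cong refl arg_cong2[of _ _ _ _ "(*)"]) (rule prod.remove[symmetric], simp_all)
  finally show ?thesis by (simp add: sum_distrib_left)
qed

lemma L_power_log_jacobian_eq_0:
  fixes F F' :: "'n \<Rightarrow> 'r"
  assumes F: "\<And>l. F l * F' l = 1" and k: "k i \<noteq> 0"
  shows "L ((\<Prod>l\<in>UNIV. zpow (F l) (F' l) (k l)) * det (\<chi> l. dlog (F l) (F' l))) = 0"
proof -
  define \<psi> where "\<psi> = (\<Prod>l\<in>UNIV. zpow (F l) (F' l) (k l))"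
  define N where "N = (\<chi> l. dlog (F l) (F' l))"
  have "(\<chi> j. D j \<psi>) = (\<Sum>m\<in>UNIV. (\<psi> * of_int (k m)) *s N $ m)"
    by (simp add: vec_eq_iff \<psi>_def D_prod_zpow[OF F] sum_distrib_left N_def mult_ac)
  then have "(\<chi> l. if l = i then (\<chi> j. D j \<psi>) else dlog (F l) (F' l)) =
      (\<chi> l. if l = i then (\<Sum>m\<in>UNIV. (\<psi> * of_int (k m)) *s N $ m) else N $ l)"
    by (simp add: N_def vec_eq_iff)
  then have "det (\<chi> l. if l = i then (\<chi> j. D j \<psi>) else dlog (F l) (F' l)) = of_int (k i) * (\<psi> * det N)"
    by (simp add: det_replace_row_sum mult_ac)
  then have "of_int (k i) * L (\<psi> * det N) = 0"
    using L_det_gradient_row[of i "\<lambda>l. dlog (F l) (F' l)" \<psi>] closed_row_dlog[OF F]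
    by (simp add: L_of_int_mult)
  then show ?thesis using torsion_free k unfolding \<psi>_def N_def by blast
qed

text \<open>Convergence enters through \<open>top_nilpotent\<close>: a power of
  \<open>u - 1\<close>, chosen for the given \<open>x\<close>, moves it out of the sight of
  \<open>L\<close>.\<close>

lemma L_det_dlog_row_eq_0:
  assumes u: "u * u' = 1" and c: "\<And>l. l \<noteq> i \<Longrightarrow> closed_row (c l)"
    and top_nilpotent: "\<And>x. \<exists>M. L ((u - 1) ^ M * x) = 0"
  shows "L (det (\<chi> l. if l = i then dlog u u' else c l)) = 0"
proof -
  let ?d = "det (\<chi> l. if l = i then dlog u u' else c l)"
  have pos: "L (u ^ m * ?d) = 0" if "m > 0" for m
  proof -
    have "D j (u ^ m) = of_nat m * u ^ m * (u' * D j u)" for j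
      using D_zpow[OF u, of j "int m"] by (simp add: zpow_def)
    then have "(\<chi> j. D j (u ^ m)) = (of_nat m * u ^ m) *s dlog u u'"
      by (simp add: vec_eq_iff dlog_def)
    then have "det (\<chi> l. if l = i then (\<chi> j. D j (u ^ m)) else c l) = of_nat m * u ^ m * ?d"
      by (simp only: det_row_mul)
    then have "L (of_nat m * (u ^ m * ?d)) = 0"
      using L_det_gradient_row[of i c "u ^ m"] c by (simp add: mult.assoc)
    then have "of_int (int m) * L (u ^ m * ?d) = 0" by (simp add: L_of_nat_mult)
    then show ?thesis using torsion_free[of "int m"] that by auto
  qed
  obtain M where M: "L ((u - 1) ^ M * ?d) = 0" using top_nilpotent by blast
  have "(u - 1) ^ M = (\<Sum>m\<le>M. of_nat (M choose m) * u ^ m * (- 1) ^ (M - m))"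
    using binomial_ring[of u "- 1" M] by simp
  then have "(u - 1) ^ M * ?d = (\<Sum>m\<le>M. of_int (int (M choose m) * (- 1) ^ (M - m)) * (u ^ m * ?d))"
    by (simp add: sum_distrib_left sum_distrib_right mult_ac)
  then have "L ((u - 1) ^ M * ?d) =
      (\<Sum>m\<le>M. of_int (int (M choose m) * (- 1) ^ (M - m)) * L (u ^ m * ?d))"
    by (simp only: L_sum L_of_int_mult)
  \<comment> \<open>Positive powers of \<open>u\<close> produce a gradient row; what remains is the
    unit \<open>(- 1) ^ M\<close> times the value sought.\<close>
  also have "\<dots> = (\<Sum>m\<in>{0}. of_int (int (M choose m) * (- 1) ^ (M - m)) * L (u ^ m * ?d))"
    by (rule sum.mono_neutral_right) (auto simp: pos)
  finally have "of_int ((- 1) ^ M) * L ?d = 0" using M by simp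
  then show ?thesis using torsion_free[of "(- 1) ^ M"] by simp
qed

text \<open>The summand \<open>dlog (u l) (u' l)\<close> is added row by row. Each addition changes
  the determinant by one with a row \<open>dlog (u i) (u' i)\<close> among closed rows, which
  \<open>L\<close> kills.\<close>

lemma L_det_dlog_mult:
  fixes m m' u u' :: "'n \<Rightarrow> 'r"
  assumes m: "\<And>l. m l * m' l = 1" and u: "\<And>l. u l * u' l = 1"
    and top_nilpotent: "\<And>l x. \<exists>M. L ((u l - 1) ^ M * x) = 0"
  shows "L (det (\<chi> l. dlog (m l * u l) (m' l * u' l))) = L (det (\<chi> l. dlog (m l) (m' l)))"
proof -
  let ?B = "\<lambda>l. dlog (m l) (m' l)" and ?U = "\<lambda>l. dlog (u l) (u' l)"
  have "L (det (\<chi> l. if l \<in> S then ?B l + ?U l else ?B l)) = L (det (\<chi> l. ?B l))"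
    if "finite S" for S
    using that
  proof (induction S rule: finite_induct)
    case (insert i S)
    let ?c = "\<lambda>l. if l \<in> S then ?B l + ?U l else ?B l"
    have c: "closed_row (?c l)" for l
      using closed_row_dlog[OF m] closed_row_dlog[OF u] closed_row_add by simp
    have "(\<chi> l. if l \<in> insert i S then ?B l + ?U l else ?B l) =
        (\<chi> l. if l = i then ?B l + ?U l else ?c l)"
      by (simp add: vec_eq_iff)
    then have "det (\<chi> l. if l \<in> insert i S then ?B l + ?U l else ?B l) =
        det (\<chi> l. if l = i then ?B l else ?c l) + det (\<chi> l. if l = i then ?U l else ?c l)"
      by (simp only: det_row_add)
    moreover have "(\<chi> l. if l = i then ?B l else ?c l) = (\<chi> l. ?c l)"
      using insert(2) by (simp add: vec_eq_iff)
    moreover have "(\<chi> l. if l = i then ?U l else ?c l) = (\<chi> l. if l = i then ?U i else ?c l)"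
      by (simp add: vec_eq_iff)
    moreover have "L (det (\<chi> l. if l = i then ?U i else ?c l)) = 0"
      by (rule L_det_dlog_row_eq_0[OF u c top_nilpotent])
    ultimately show ?case using insert(3) by (simp add: L_add)
  qed simp
  from this[of UNIV] show ?thesis by (simp add: dlog_mult m u)
qed

end

section \<open>Summable families and geometric series\<close>

lemma hsum_superset:
  assumes "finite J" "J \<subseteq> I" "{i \<in> I. s i a \<noteq> 0} \<subseteq> J"
  shows "hsum s I a = (\<Sum>i\<in>J. s i a)"
  unfolding hsum_def by (rule sum.mono_neutral_left) (use assms in auto)

text \<open>At a fixed exponent only finitely many splittings occur, each meeting finitely many
  members of the family, so only finite sums are interchanged.\<close>

lemma hmul_hsum:
  fixes s :: "'i \<Rightarrow> 'a::ab_group_add \<Rightarrow> 'k::comm_ring_1"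
  assumes U: "good_support le (\<Union>i\<in>I. hsupp (s i))" and fin: "\<And>a. finite {i \<in> I. s i a \<noteq> 0}"
    and g: "good_support le (hsupp g)"
  shows "hmul (hsum s I) g = hsum (\<lambda>i. hmul (s i) g) I"
proof
  fix c
  let ?U = "\<Union>i\<in>I. hsupp (s i)"
  let ?A = "{a \<in> ?U. c - a \<in> hsupp g}"
  let ?J = "\<Union>a\<in>?A. {i \<in> I. s i a \<noteq> 0}"
  have finA: "finite ?A" by (rule good_support_finite[OF U g])
  have finJ: "finite ?J" by (rule finite_UN_I[OF finA fin])
  have "hsupp (hsum s I) \<subseteq> ?U"
  proof
    fix a assume "a \<in> hsupp (hsum s I)"
    then have "{i \<in> I. s i a \<noteq> 0} \<noteq> {}" unfolding hsupp_def hsum_def by (metis (mono_tags) mem_Collect_eq sum.empty)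
    then show "a \<in> ?U" by (auto simp: hsupp_def)
  qed
  then have "hmul (hsum s I) g c = (\<Sum>a\<in>?A. hsum s I a * g (c - a))"
    by (rule hmul_eq_sum_good[OF U g _ subset_refl])
  also have "\<dots> = (\<Sum>a\<in>?A. (\<Sum>i\<in>?J. s i a) * g (c - a))"
    by (intro sum.cong refl arg_cong2[of _ _ _ _ "(*)"] hsum_superset finJ) auto
  also have "\<dots> = (\<Sum>i\<in>?J. \<Sum>a\<in>?A. s i a * g (c - a))"
    unfolding sum_distrib_right by (rule sum.swap)
  also have "\<dots> = (\<Sum>i\<in>?J. hmul (s i) g c)"
  proof (rule sum.cong[OF refl])
    fix i assume "i \<in> ?J"
    then have "hsupp (s i) \<subseteq> ?U" by auto
    then show "(\<Sum>a\<in>?A. s i a * g (c - a)) = hmul (s i) g c"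
      by (rule hmul_eq_sum_good[OF U g _ subset_refl, symmetric])
  qed
  also have "\<dots> = hsum (\<lambda>i. hmul (s i) g) I c"
  proof (rule hsum_superset[symmetric, OF finJ])
    show "{i \<in> I. hmul (s i) g c \<noteq> 0} \<subseteq> ?J"
    proof
      fix i assume i: "i \<in> {i \<in> I. hmul (s i) g c \<noteq> 0}"
      then have "c \<in> hsupp (hmul (s i) g)" by (simp add: hsupp_def)
      then obtain a b where "c = a + b" "a \<in> hsupp (s i)" "b \<in> hsupp g" by (rule hsupp_hmulE)
      then show "i \<in> ?J" using i by (auto simp: hsupp_def intro!: exI[of _ a])
    qed
  qed auto
  finally show "hmul (hsum s I) g c = hsum (\<lambda>i. hmul (s i) g) I c" .
qed

definition word_sums :: "'a::monoid_add set \<Rightarrow> 'a set" where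
  "word_sums E = sum_list ` {w. set w \<subseteq> E}"

lemma zero_in_word_sums [simp]: "0 \<in> word_sums E"
  unfolding word_sums_def by (rule image_eqI[of _ _ "[]"]) auto

lemma word_sums_add: "a \<in> word_sums E \<Longrightarrow> b \<in> word_sums E \<Longrightarrow> a + b \<in> word_sums E"
  unfolding word_sums_def by (auto intro!: image_eqI[of _ _ "_ @ _"])

lemma subset_word_sums: "E \<subseteq> word_sums E"
  unfolding word_sums_def by (auto intro!: image_eqI[of _ _ "[_]"])

text \<open>The exact word length is recorded because it is what bounds the powers that reach a
  given exponent.\<close>

lemma hsupp_power:
  assumes "hsupp (proj \<epsilon> le) \<subseteq> E"
  shows "hsupp (proj (\<epsilon> ^ r) le) \<subseteq> sum_list ` {w. set w \<subseteq> E \<and> length w = r}"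
proof (induction r)
  case 0
  show ?case using hsupp_hone_subset by (auto intro!: image_eqI[of _ _ "[]"])
next
  case (Suc r)
  show ?case
  proof
    fix c assume "c \<in> hsupp (proj (\<epsilon> ^ Suc r) le)"
    then obtain a b where "c = a + b" "a \<in> hsupp (proj \<epsilon> le)" "b \<in> hsupp (proj (\<epsilon> ^ r) le)"
      unfolding power_Suc proj_mult by (rule hsupp_hmulE)
    then obtain w where "set w \<subseteq> E" "length w = r" "b = sum_list w" "a \<in> E" using Suc assms by blast
    then show "c \<in> sum_list ` {w. set w \<subseteq> E \<and> length w = Suc r}"
      using \<open>c = a + b\<close> by (auto intro!: image_eqI[of _ _ "a # w"])
  qed
qed

locale positive_set = toa_group +
  fixes E
  assumes wo: "wo_on le E" and nonneg: "\<And>e. e \<in> E \<Longrightarrow> 0 \<preceq> e" and zero_notin: "0 \<notin> E"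
begin

lemma wo_word_sums: "wo_on le (word_sums E)"
  unfolding word_sums_def by (rule neumann_wo_on[OF wo nonneg zero_notin])

lemma hsupp_power_word_sums:
  "hsupp (proj \<epsilon> le) \<subseteq> E \<Longrightarrow> hsupp (proj (\<epsilon> ^ r) le) \<subseteq> word_sums E"
  using hsupp_power[of \<epsilon> le E r] by (auto simp: word_sums_def)

text \<open>By Neumann's lemma \<open>a\<close> is the sum of finitely many words in
  \<open>E\<close>; take \<open>N\<close> beyond all their lengths.\<close>

lemma power_eventually_0:
  assumes "hsupp (proj \<epsilon> le) \<subseteq> E"
  shows "\<exists>N. \<forall>r\<ge>N. proj (\<epsilon> ^ r) le a = 0"
proof -
  have "finite (length ` {w. set w \<subseteq> E \<and> sum_list w = a})"
    by (intro finite_imageI neumann_finite wo nonneg zero_notin)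
  then obtain N where N: "\<And>w. set w \<subseteq> E \<Longrightarrow> sum_list w = a \<Longrightarrow> length w < N"
    by (auto simp: finite_nat_set_iff_bounded)
  have "proj (\<epsilon> ^ r) le a = 0" if "r \<ge> N" for r
  proof (rule ccontr)
    assume "proj (\<epsilon> ^ r) le a \<noteq> 0"
    then have "a \<in> hsupp (proj (\<epsilon> ^ r) le)" by (simp add: hsupp_def)
    then obtain w where "set w \<subseteq> E" "length w = r" "a = sum_list w"
      using hsupp_power[OF assms] by blast
    then show False using N[of w] that by simp
  qed
  then show ?thesis by blast
qed

lemma power_mult_eventually_0:
  assumes "hsupp (proj \<epsilon> le) \<subseteq> E"
  shows "\<exists>M. proj (\<epsilon> ^ M * X) le c = 0"
proof -
  let ?A = "{a \<in> word_sums E. c - a \<in> hsupp (proj X le)}"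
  have W: "good_support le (word_sums E)" using wo_word_sums toa by (simp add: good_support_iff)
  have fin: "finite ?A" by (rule good_support_finite[OF W good_support_proj])
  obtain N where N: "\<And>a r. N a \<le> r \<Longrightarrow> proj (\<epsilon> ^ r) le a = 0"
    using power_eventually_0[OF assms] by metis
  \<comment> \<open>The sum of the thresholds serves as a common upper bound for the finitely many
    exponents that can contribute at \<open>c\<close>.\<close>
  define M where "M = (\<Sum>a\<in>?A. N a)"
  have "N a \<le> M" if "a \<in> ?A" for a
    unfolding M_def using fin that by (intro member_le_sum) auto
  then have "(\<Sum>a\<in>?A. proj (\<epsilon> ^ M) le a * proj X le (c - a)) = 0"
    by (intro sum.neutral) (simp add: N)
  then show ?thesis
    using hmul_eq_sum_good[OF W good_support_proj hsupp_power_word_sums[OF assms] subset_refl]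
    by (metis (no_types, lifting) proj_mult)
qed

text \<open>At \<open>le\<close> the inverse is the geometric series in \<open>- \<epsilon>\<close>.
  At every other relation \<open>1 + \<epsilon>\<close> is \<open>1\<close>, matching the default of
  \<open>at_order\<close>.\<close>

lemma one_plus_inverse:
  fixes \<epsilon> :: "('a, 'k::comm_ring_1) hfam"
  assumes supp: "hsupp (proj \<epsilon> le) \<subseteq> E" and other: "\<And>le'. le' \<noteq> le \<Longrightarrow> proj \<epsilon> le' = (\<lambda>_. 0)"
  obtains Y where "(1 + \<epsilon>) * Y = 1" "hsupp (proj Y le) \<subseteq> word_sums E"
proof -
  define s where "s r = proj ((- \<epsilon>) ^ r) le" for r
  have supp': "hsupp (proj (- \<epsilon>) le) \<subseteq> E" using supp by (auto simp: hsupp_def)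
  have W: "good_support le (word_sums E)" using wo_word_sums toa by (simp add: good_support_iff)
  have sW: "hsupp (s r) \<subseteq> word_sums E" for r
    unfolding s_def by (rule hsupp_power_word_sums[OF supp'])
  have U: "good_support le (\<Union>r. hsupp (s r))"
    by (rule good_support_subset[OF W]) (use sW in blast)
  obtain N where N: "\<And>a r. N a \<le> r \<Longrightarrow> s r a = 0"
    using power_eventually_0[OF supp'] unfolding s_def by metis
  have bnd: "{r. s r a \<noteq> 0} \<subseteq> {..<N a}" for a
    using N by (metis (mono_tags, lifting) lessThan_iff linorder_not_less mem_Collect_eq subsetI)
  have fin: "finite {r \<in> UNIV. s r a \<noteq> 0}" for a
    using finite_subset[OF bnd[of a] finite_lessThan] by simp
  define y where "y = hsum s UNIV"
  have ysupp: "hsupp y \<subseteq> (\<Union>r. hsupp (s r))"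
  proof
    fix a assume "a \<in> hsupp y"
    then have "{r \<in> UNIV. s r a \<noteq> 0} \<noteq> {}"
      unfolding hsupp_def y_def hsum_def by (metis (mono_tags) mem_Collect_eq sum.empty)
    then show "a \<in> (\<Union>r. hsupp (s r))" by (auto simp: hsupp_def)
  qed
  then have ygood: "good_support le (hsupp y)" by (rule good_support_subset[OF U])
  have "hmul y (proj (1 + \<epsilon>) le) c = hone c" for c
  proof -
    \<comment> \<open>This makes the sum up to \<open>N c\<close> telescope; its last term vanishes
      at \<open>c\<close>.\<close>
    have step: "hmul (s r) (proj (1 + \<epsilon>) le) a = s r a - s (Suc r) a" for r a
    proof -
      have "(- \<epsilon>) ^ r * (1 + \<epsilon>) = (- \<epsilon>) ^ r - (- \<epsilon>) ^ Suc r" by (simp add: algebra_simps)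
      then show ?thesis unfolding s_def proj_mult[symmetric] by simp
    qed
    have "hmul y (proj (1 + \<epsilon>) le) c = hsum (\<lambda>r. hmul (s r) (proj (1 + \<epsilon>) le)) UNIV c"
      unfolding y_def by (rule fun_cong[OF hmul_hsum[OF U fin good_support_proj]])
    also have "\<dots> = (\<Sum>r<N c. hmul (s r) (proj (1 + \<epsilon>) le) c)"
    proof (rule hsum_superset)
      show "{r \<in> UNIV. hmul (s r) (proj (1 + \<epsilon>) le) c \<noteq> 0} \<subseteq> {..<N c}"
      proof (rule subsetI, rule ccontr)
        fix r assume r: "r \<in> {r \<in> UNIV. hmul (s r) (proj (1 + \<epsilon>) le) c \<noteq> 0}" and "r \<notin> {..<N c}"
        then have "s r c = 0" "s (Suc r) c = 0" by (auto intro: N)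
        then show False using r by (simp add: step)
      qed
    qed auto
    also have "\<dots> = s 0 c - s (N c) c" unfolding step by (rule sum_lessThan_telescope')
    also have "\<dots> = hone c" using N[of c "N c"] by (simp add: s_def)
    finally show ?thesis .
  qed
  then have y: "hmul (proj (1 + \<epsilon>) le) y = hone" by (subst hmul_commute) blast
  have "(1 + \<epsilon>) * at_order le y = 1"
  proof (rule hfam_eqI)
    fix le' a
    show "proj ((1 + \<epsilon>) * at_order le y) le' a = proj 1 le' a"
    proof (cases "le' = le")
      case True
      then show ?thesis using y by (simp add: proj_mult proj_at_order ygood)
    next
      case False
      then have "proj (1 + \<epsilon>) le' = hone" by (simp add: fun_eq_iff other)
      then show ?thesis using False by (simp add: proj_mult proj_at_order_other)
    qed
  qed
  moreover have "hsupp (proj (at_order le y) le) \<subseteq> word_sums E"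
    using ysupp sW by (auto simp: proj_at_order ygood)
  ultimately show ?thesis by (rule that)
qed

end

section \<open>Comparison with concrete series\<close>

lemma proj_of_nat_mult: "proj (of_nat m * X) le a = of_nat m * proj X le a"
  by (induction m) (simp_all add: distrib_right)

lemma proj_of_int_mult: "proj (of_int m * X) le a = of_int m * proj X le a"
proof (cases m)
  case (nonneg n)
  then show ?thesis by (simp add: proj_of_nat_mult)
next
  case (neg n)
  then have "of_int m * X = - (of_nat (Suc n) * X)"
    and "of_int m * proj X le a = - (of_nat (Suc n) * proj X le a)" 
    by (simp_all only: neg of_int_minus of_int_of_nat_eq mult_minus_left)
  then show ?thesis by (simp only: proj_minus proj_of_nat_mult)
qed

lemma reduce_of_int_mult: "reduce le (of_int m * X) a = of_int m * reduce le X a"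
  by (simp add: reduce_def proj_of_int_mult cover_map_mult)

text \<open>The product before reduction is commutative, so the enumeration chosen inside
  \<open>hprod\<close> does not affect the value.\<close>

lemma hprod_reduce:
  fixes X :: "'n::finite \<Rightarrow> ('a::ab_group_add, 'k::field cover) hfam"
  shows "hprod (\<lambda>i. reduce le (X i)) = reduce le (\<Prod>i\<in>UNIV. X i)"
proof -
  define xs where "xs = (SOME xs. distinct xs \<and> set xs = (UNIV :: 'n set))"
  have xs: "distinct xs" "set xs = UNIV"
    using someI_ex[of "\<lambda>xs. distinct xs \<and> set xs = (UNIV :: 'n set)"]
      finite_distinct_list[OF finite_class.finite_UNIV]
    unfolding xs_def by metis+
  have "foldr hmul (map (\<lambda>i. reduce le (X i)) ys) hone = reduce le (prod_list (map X ys))" for ys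
    by (induction ys) (simp_all add: reduce_mult)
  then show ?thesis
    using prod.distinct_set_conv_list[OF xs(1), of X] xs(2) by (simp add: hprod_def xs_def[symmetric])
qed

lemma hdet_reduce: "hdet (\<lambda>i j. reduce le (M $ i $ j)) = reduce le (det M)"
  by (simp add: hdet_def det_def hprod_reduce reduce_sum reduce_of_int_mult)

definition monom_at :: "('a::ab_group_add \<Rightarrow> 'a \<Rightarrow> bool) \<Rightarrow> 'k::comm_ring_1 \<Rightarrow> 'a \<Rightarrow> ('a, 'k) hfam" where
  "monom_at le c a = at_order le (\<lambda>b. if b = a then c else 0)"

context toa_group
begin

lemma hahn_iff: "f \<in> hahn le \<longleftrightarrow> good_support le (hsupp f)"
  using toa by (simp add: hahn_def good_support_iff)

lemma good_support_singleton [simp]: "good_support le {a}"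
  using toa by (simp add: good_support_iff)

lemma good_support_monom [simp]: "good_support le (hsupp (\<lambda>b. if b = a then c else 0))"
  by (rule good_support_subset[OF good_support_singleton[of a]]) (auto simp: hsupp_def)

lemma proj_monom_at: "proj (monom_at le c a) le = (\<lambda>b. if b = a then c else 0)"
  by (simp add: monom_at_def proj_at_order)

lemma proj_monom_at_mult: "proj (monom_at le c a * X) le b = c * proj X le (b - a)"
  unfolding proj_mult proj_monom_at by (subst hmul_eq_sum[of "{a}"]) auto

lemma monom_at_inverse:
  assumes "c * d = 1"
  shows "monom_at le c a * monom_at le d (- a) = 1"
proof (rule hfam_eqI)
  fix le' b
  show "proj (monom_at le c a * monom_at le d (- a)) le' b = proj 1 le' b"
  proof (cases "le' = le")
    case True
    then show ?thesis using assms by (simp add: proj_monom_at_mult proj_monom_at hone_def)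
  next
    case False
    then show ?thesis by (simp add: proj_mult monom_at_def proj_at_order_other)
  qed
qed

text \<open>Any inverse found in the cover determines \<open>hinv\<close>, since associativity makes
  inverses with well-ordered support unique.\<close>

lemma hinv_reduce:
  assumes "X * Y = 1"
  shows "hinv le (reduce le X) = reduce le Y"
  unfolding hinv_def
proof (rule the_equality)
  have "hmul (reduce le X) (reduce le Y) = hone" using assms by (simp add: reduce_mult[symmetric])
  then show "reduce le Y \<in> hahn le \<and> hmul (reduce le X) (reduce le Y) = hone"
    by (simp add: hahn_iff)
  fix g assume g: "g \<in> hahn le \<and> hmul (reduce le X) g = hone"
  have "Y * X = 1" using assms by (simp add: mult.commute)
  then have "g = hmul (hmul (reduce le Y) (reduce le X)) g" by (simp add: reduce_mult[symmetric])
  also have "\<dots> = hmul (reduce le Y) (hmul (reduce le X) g)"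
    using g by (intro hmul_assoc) (auto simp: hahn_iff)
  finally show "g = reduce le Y" using g by simp
qed

lemma hpow_reduce:
  fixes X Y :: "('a, 'k::field cover) hfam"
  assumes "X * Y = 1"
  shows "hpow le (reduce le X) k = reduce le (zpow X Y k)"
proof -
  have "(hmul (reduce le Z) ^^ m) hone = reduce le (Z ^ m)" for Z :: "('a, 'k cover) hfam" and m
    by (induction m) (simp_all add: reduce_mult)
  then show ?thesis by (simp add: hpow_def zpow_def hinv_reduce[OF assms])
qed

lemma init_exp_least:
  assumes "f \<in> hahn le" "f \<noteq> (\<lambda>_. 0)"
  shows "init_exp le f \<in> hsupp f" "b \<in> hsupp f \<Longrightarrow> init_exp le f \<preceq> b"
proof -
  have "hsupp f \<noteq> {}" using assms(2) by (auto simp: hsupp_def)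
  then obtain m where m: "m \<in> hsupp f" "\<forall>x\<in>hsupp f. m \<preceq> x"
    using assms(1) unfolding hahn_def wo_on_def by blast
  have "init_exp le f = m"
    unfolding init_exp_def using m by (intro the_equality) (auto intro: le_antisym)
  then show "init_exp le f \<in> hsupp f" "b \<in> hsupp f \<Longrightarrow> init_exp le f \<preceq> b" using m by auto
qed

lemma init_expI:
  assumes "a \<in> hsupp f" "\<And>b. b \<in> hsupp f \<Longrightarrow> a \<preceq> b"
  shows "init_exp le f = a"
  unfolding init_exp_def using assms by (intro the_equality) (auto intro: le_antisym)

end

locale xseries = toa_group le
  for le :: "'g::ab_group_add \<times> (int^'n::finite) \<Rightarrow> 'g \<times> (int^'n) \<Rightarrow> bool"
    (infix "\<preceq>" 50)
begin

text \<open>Initial exponents of different slices differ in their second component, and the least of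
  them is the initial exponent of \<open>f\<close> itself.\<close>

lemma xinit_eq:
  assumes "f \<in> hahn le" "f \<noteq> (\<lambda>_. 0)"
  shows "xinit le f = snd (init_exp le f)"
proof -
  define a where "a = init_exp le f"
  have a: "a \<in> hsupp f" "\<And>b. b \<in> hsupp f \<Longrightarrow> a \<preceq> b"
    using init_exp_least[OF assms] by (auto simp: a_def)
  have supp: "hsupp (xslice f k) = {b \<in> hsupp f. snd b = k}" for k
    by (auto simp: hsupp_def xslice_def split: if_splits)
  have hahn: "xslice f k \<in> hahn le" for k
    using assms(1) wo_on_subset[of "hsupp f" "hsupp (xslice f k)"] by (auto simp: hahn_def supp)
  have least: "init_exp le (xslice f k) \<in> hsupp f \<and> snd (init_exp le (xslice f k)) = k"
    if "xslice f k \<noteq> (\<lambda>_. 0)" for k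
    using init_exp_least(1)[OF hahn that] by (simp add: supp)
  have ia: "init_exp le (xslice f (snd a)) = a"
    by (rule init_expI) (use a in \<open>auto simp: supp\<close>)
  have nz: "xslice f (snd a) \<noteq> (\<lambda>_. 0)"
    using a(1) supp[of "snd a"] by (auto simp: hsupp_def)
  show ?thesis
    unfolding xinit_def a_def[symmetric]
  proof (rule the_equality)
    show "xslice f (snd a) \<noteq> (\<lambda>_. 0) \<and> (\<forall>k'. xslice f k' \<noteq> (\<lambda>_. 0) \<longrightarrow>
        init_exp le (xslice f (snd a)) \<preceq> init_exp le (xslice f k'))"
      using nz least a(2) unfolding ia by blast
    fix k assume k: "xslice f k \<noteq> (\<lambda>_. 0) \<and> (\<forall>k'. xslice f k' \<noteq> (\<lambda>_. 0) \<longrightarrow>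
        init_exp le (xslice f k) \<preceq> init_exp le (xslice f k'))"
    then have "init_exp le (xslice f k) \<preceq> a" using nz ia by metis
    then have "init_exp le (xslice f k) = a" using least k a(2) le_antisym by blast
    then show "k = snd a" using least k by metis
  qed
qed

definition x :: "'n \<Rightarrow> ('g \<times> (int^'n), 'k::field cover) hfam" where
  "x j = monom_at le 1 (0, axis j 1)"

definition x_inv :: "'n \<Rightarrow> ('g \<times> (int^'n), 'k::field cover) hfam" where
  "x_inv j = monom_at le 1 (- (0, axis j 1))"

text \<open>The Euler operator of \<open>x_j\<close>. It preserves exponents, so that its image has
  no constant term in \<open>x\<close>.\<close>

definition Dx :: "'n \<Rightarrow> ('g \<times> (int^'n), 'k::field cover) hfam \<Rightarrow> ('g \<times> (int^'n), 'k cover) hfam" where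
  "Dx j = hderiv (\<lambda>a. snd a $ j)"

lemma x_x_inv: "x j * x_inv j = 1"
  unfolding x_def x_inv_def by (rule monom_at_inverse) simp

lemma xvar_reduce: "xvar j = reduce le (x j)"
  by (auto simp: xvar_def tpow_def reduce_def x_def proj_monom_at)

lemma hpderiv_reduce: "hpderiv j (reduce le X) = reduce le (x_inv j * Dx j X)"
proof
  fix a :: "'g \<times> (int^'n)"
  obtain g h where a: "a = (g, h)" by force
  have "reduce le (x_inv j * Dx j X) (g, h) = of_int (h $ j + 1) * cover_map (proj X le (g, h + axis j 1))"
    unfolding reduce_def x_inv_def Dx_def proj_monom_at_mult
    by (simp add: cover_map_mult cover_map_add)
  then show "hpderiv j (reduce le X) a = reduce le (x_inv j * Dx j X) a"
    by (simp add: a hpderiv_def reduce_def)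
qed

lemma proj_prod_x_inv_mult:
  assumes "finite S"
  shows "proj ((\<Prod>j\<in>S. x_inv j) * X) le (g, h) = proj X le (g, h + (\<Sum>j\<in>S. axis j 1))"
  using assms
proof (induction S arbitrary: h rule: finite_induct)
  case (insert i S)
  have "proj ((\<Prod>j\<in>insert i S. x_inv j) * X) le (g, h) =
      proj (x_inv i * ((\<Prod>j\<in>S. x_inv j) * X)) le (g, h)"
    using insert by (simp add: mult.assoc)
  also have "\<dots> = proj ((\<Prod>j\<in>S. x_inv j) * X) le (g, h + axis i 1)"
    by (simp add: x_inv_def[of i] proj_monom_at_mult)
  finally show ?case using insert by (simp add: add.assoc)
qed simp

text \<open>One coefficient \<open>(g, 0)\<close> is read at a time, so the target is the
  torsion-free cover itself.\<close>

lemma residue_functional_CT: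
  "residue_functional Dx (\<lambda>X :: ('g \<times> (int^'n), 'k::field cover) hfam. proj X le (g, 0))"
proof
  fix j i :: 'n and X Y :: "('g \<times> (int^'n), 'k cover) hfam" and m :: int and s :: "'k cover"
  show "Dx j (X + Y) = Dx j X + Dx j Y" by (simp add: Dx_def hderiv_add)
  show "Dx j (X * Y) = Dx j X * Y + X * Dx j Y" unfolding Dx_def by (rule hderiv_mult) simp
  show "Dx i (Dx j X) = Dx j (Dx i X)" unfolding Dx_def by (rule hderiv_commute)
  show "proj (X + Y) le (g, 0) = proj X le (g, 0) + proj Y le (g, 0)" by simp
  show "proj (Dx j X) le (g, 0) = 0" by (simp add: Dx_def)
  show "of_int m * s = 0 \<Longrightarrow> m = 0 \<or> s = 0" by (rule cover_torsion_free)
qed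

end

section \<open>The residue theorem\<close>

lemma fst_zmul: "fst (zmul k a) = zmul k (fst a)"
  by (simp add: zmul_def fst_sum)

lemma snd_zmul:
  fixes a :: "'g::ab_group_add \<times> (int^'n)"
  shows "snd (zmul k a) = k *s snd a"
  by (simp add: zmul_def snd_sum vec_eq_iff sum_component del: sum_constant) simp

lemma fendo_eq_sum: "fendo le F (g, k) = (g, 0) + (\<Sum>i\<in>UNIV. zmul (k $ i) (init_exp le (F i)))"
  by (simp add: fendo_def prod_eq_iff fst_sum snd_sum fst_zmul snd_zmul)

lemma fendo_split: "fendo le F (g, k) = (g, 0) + fendo le F (0, k)"
  by (simp add: fendo_def prod_eq_iff)

locale residue_setting = xseries le
  for le :: "'g::ab_group_add \<times> (int^'n::finite) \<Rightarrow> 'g \<times> (int^'n) \<Rightarrow> bool" (infix "\<preceq>" 50) +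
  fixes F :: "'n \<Rightarrow> 'g \<times> (int^'n) \<Rightarrow> 'k::field"
  assumes F_hahn: "\<And>i. F i \<in> hahn le" and F_nz: "\<And>i. F i \<noteq> (\<lambda>_. 0)"
    and jacnum_nz: "jacnum le F \<noteq> 0"
begin

abbreviation a0 :: "'n \<Rightarrow> 'g \<times> (int^'n)" where
  "a0 i \<equiv> init_exp le (F i)"

lemma a0_supp: "F i (a0 i) \<noteq> 0" and a0_least: "F i b \<noteq> 0 \<Longrightarrow> a0 i \<preceq> b"
  using init_exp_least[OF F_hahn[of i] F_nz[of i]] by (auto simp: hsupp_def)

lemma jacnum_eq: "jacnum le F = det (\<chi> i j. snd (a0 i) $ j)"
  by (simp add: jacnum_def xinit_eq F_hahn F_nz)

lemma fendo_inj: "inj (fendo le F)"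
proof (rule injI)
  fix p q assume eq: "fendo le F p = fendo le F q"
  obtain g h g' h' where pq: "p = (g, h)" "q = (g', h')" by force
  define B where "B = (\<chi> i. snd (a0 i))"
  have B: "det B \<noteq> 0" using jacnum_nz unfolding jacnum_eq B_def by (simp add: vec_lambda_eta)
  have "(\<Sum>i\<in>UNIV. h $ i *s snd (a0 i)) = (\<Sum>i\<in>UNIV. h' $ i *s snd (a0 i))"
    using eq by (simp add: pq fendo_def)
  then have z: "(\<Sum>i\<in>UNIV. (h - h') $ i *s B $ i) = 0"
    by (simp add: B_def vector_sub_rdistrib sum_subtractf)
  \<comment> \<open>Cramer's rule: replacing row \<open>l\<close> of \<open>B\<close> by a vanishing
    combination of the rows gives determinant \<open>0\<close>.\<close>
  have "(h - h') $ l * det B = 0" for l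
    using det_replace_row_sum[of l "\<lambda>i. (h - h') $ i" B] unfolding z by (simp add: det_row_0)
  then have "h = h'" using B by (auto simp: vec_eq_iff)
  then show "p = q" using eq by (simp add: pq fendo_def)
qed

section \<open>Lifted series, factored into initial monomial and principal unit\<close>

definition Ft :: "'n \<Rightarrow> ('g \<times> (int^'n), 'k cover) hfam" where
  "Ft i = at_order le (\<lambda>b. cover_lift (F i b))"

definition \<mu> :: "'n \<Rightarrow> ('g \<times> (int^'n), 'k cover) hfam" where
  "\<mu> i = monom_at le (cover_lift (F i (a0 i))) (a0 i)"

definition \<mu>_inv :: "'n \<Rightarrow> ('g \<times> (int^'n), 'k cover) hfam" where
  "\<mu>_inv i = monom_at le (cover_lift (inverse (F i (a0 i)))) (- a0 i)"

definition u :: "'n \<Rightarrow> ('g \<times> (int^'n), 'k cover) hfam" where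
  "u i = \<mu>_inv i * Ft i"

text \<open>One set for all \<open>i\<close>, so that a single monoid controls the supports of all
  units \<open>u i\<close> and their inverses.\<close>

definition E :: "('g \<times> (int^'n)) set" where
  "E = (\<Union>i. {b. F i (b + a0 i) \<noteq> 0 \<and> b \<noteq> 0})"

lemma \<mu>_inverse: "\<mu> i * \<mu>_inv i = 1"
  unfolding \<mu>_def \<mu>_inv_def by (rule monom_at_inverse) (rule cover_lift_inverse[OF a0_supp])

lemma proj_Ft: "proj (Ft i) le = (\<lambda>b. cover_lift (F i b))"
proof -
  have "hsupp (\<lambda>b. cover_lift (F i b)) = hsupp (F i)" by (simp add: hsupp_def)
  then show ?thesis using F_hahn[of i] by (simp add: Ft_def proj_at_order hahn_iff)
qed

lemma reduce_Ft: "reduce le (Ft i) = F i"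
  by (simp add: reduce_def proj_Ft)

lemma Ft_eq: "Ft i = \<mu> i * u i"
  using \<mu>_inverse[of i] by (simp add: u_def mult.assoc[symmetric])

lemma hsupp_u_minus_1: "hsupp (proj (u i - 1) le) \<subseteq> E"
proof -
  have "proj (u i) le b = cover_lift (inverse (F i (a0 i))) * cover_lift (F i (b + a0 i))" for b
    by (simp add: u_def \<mu>_inv_def proj_monom_at_mult proj_Ft)
  moreover have "cover_lift (inverse (F i (a0 i))) * cover_lift (F i (a0 i)) = 1"
    using cover_lift_inverse[OF a0_supp] by (simp add: mult.commute)
  ultimately have "F i (b + a0 i) \<noteq> 0 \<and> b \<noteq> 0" if "proj (u i - 1) le b \<noteq> 0" for b
    using that by (cases "b = 0") (auto simp: hone_def cover_lift_def[of 0] simp del: split_paired_All)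
  then show ?thesis by (auto simp: hsupp_def E_def)
qed

lemma u_other: "le' \<noteq> le \<Longrightarrow> proj (u i - 1) le' = (\<lambda>_. 0)"
  by (simp add: fun_eq_iff u_def \<mu>_inv_def monom_at_def Ft_def proj_mult proj_at_order_other)

sublocale positive_set le E
proof
  have "wo_on le {b. F i (b + a0 i) \<noteq> 0 \<and> b \<noteq> 0}" for i
  proof -
    have "wo_on le {a + b |a b. a \<in> hsupp (F i) \<and> b \<in> {- a0 i}}"
      using F_hahn[of i] by (intro wo_on_sums) (auto simp: hahn_def)
    then show ?thesis
    proof (rule wo_on_subset)
      have "\<exists>a. b = a + - a0 i \<and> F i a \<noteq> 0" if "F i (b + a0 i) \<noteq> 0" for b
        using that by (intro exI[of _ "b + a0 i"]) simp
      then show "{b. F i (b + a0 i) \<noteq> 0 \<and> b \<noteq> 0} \<subseteq> {a + b |a b. a \<in> hsupp (F i) \<and> b \<in> {- a0 i}}"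
        unfolding hsupp_def by blast
    qed
  qed
  then show "wo_on le E" unfolding E_def by (intro wo_on_finite_UN) auto
  show "0 \<notin> E" by (simp add: E_def)
  fix e assume "e \<in> E"
  then obtain i where "F i (e + a0 i) \<noteq> 0" by (auto simp: E_def)
  then have "0 + a0 i \<preceq> e + a0 i" using a0_least by simp
  then show "0 \<preceq> e" by (simp only: le_add_cancel_right)
qed

definition u_inv :: "'n \<Rightarrow> ('g \<times> (int^'n), 'k cover) hfam" where
  "u_inv i = (SOME Y. u i * Y = 1 \<and> hsupp (proj Y le) \<subseteq> word_sums E)"

lemma u_inverse: "u i * u_inv i = 1" and hsupp_u_inv: "hsupp (proj (u_inv i) le) \<subseteq> word_sums E"
proof -
  obtain Y where "(1 + (u i - 1)) * Y = 1" "hsupp (proj Y le) \<subseteq> word_sums E"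
    using one_plus_inverse[OF hsupp_u_minus_1 u_other] by blast
  then have "\<exists>Y. u i * Y = 1 \<and> hsupp (proj Y le) \<subseteq> word_sums E" by auto
  then have "u i * u_inv i = 1 \<and> hsupp (proj (u_inv i) le) \<subseteq> word_sums E"
    unfolding u_inv_def by (rule someI_ex)
  then show "u i * u_inv i = 1" "hsupp (proj (u_inv i) le) \<subseteq> word_sums E" by auto
qed

definition Ft_inv :: "'n \<Rightarrow> ('g \<times> (int^'n), 'k cover) hfam" where
  "Ft_inv i = \<mu>_inv i * u_inv i"

lemma Ft_inverse: "Ft i * Ft_inv i = 1"
proof -
  have "Ft i * Ft_inv i = (\<mu> i * \<mu>_inv i) * (u i * u_inv i)"
    by (simp add: Ft_eq Ft_inv_def mult_ac)
  then show ?thesis by (simp add: \<mu>_inverse u_inverse)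
qed

definition Ft_pow :: "int^'n \<Rightarrow> ('g \<times> (int^'n), 'k cover) hfam" where
  "Ft_pow k = (\<Prod>i\<in>UNIV. zpow (Ft i) (Ft_inv i) (k $ i))"

lemma Fpow_reduce: "Fpow le F k = reduce le (Ft_pow k)"
proof -
  have "hpow le (F i) m = reduce le (zpow (Ft i) (Ft_inv i) m)" for i m
    using hpow_reduce[OF Ft_inverse, of i m] by (simp add: reduce_Ft)
  then show ?thesis by (simp add: Fpow_def Ft_pow_def hprod_reduce)
qed

text \<open>As \<open>word_sums E\<close> is closed under addition, the starting exponents add up in
  products; for the powers of \<open>F\<close> they add up to \<open>fendo\<close>.\<close>

definition supp_from :: "('g \<times> (int^'n), 'k cover) hfam \<Rightarrow> 'g \<times> (int^'n) \<Rightarrow> bool" where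
  "supp_from X a \<longleftrightarrow> (\<forall>b. proj X le b \<noteq> 0 \<longrightarrow> b - a \<in> word_sums E)"

lemma supp_from_one: "supp_from 1 0"
  by (auto simp: supp_from_def hone_def)

lemma supp_from_mult:
  assumes "supp_from X a" "supp_from Y b"
  shows "supp_from (X * Y) (a + b)"
  unfolding supp_from_def
proof (intro allI impI)
  fix c assume "proj (X * Y) le c \<noteq> 0"
  then have "c \<in> hsupp (hmul (proj X le) (proj Y le))" by (simp add: hsupp_def proj_mult)
  then obtain d e where de: "c = d + e" "d \<in> hsupp (proj X le)" "e \<in> hsupp (proj Y le)"
    by (rule hsupp_hmulE)
  then have "(d - a) + (e - b) \<in> word_sums E"
    using assms unfolding supp_from_def hsupp_def by (intro word_sums_add) blast+
  then show "c - (a + b) \<in> word_sums E" using de(1) by (simp add: algebra_simps)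
qed

lemma supp_from_prod:
  assumes "finite I" "\<And>i. i \<in> I \<Longrightarrow> supp_from (X i) (a i)"
  shows "supp_from (\<Prod>i\<in>I. X i) (\<Sum>i\<in>I. a i)"
  using assms by (induction I rule: finite_induct) (auto intro: supp_from_one supp_from_mult)

lemma supp_from_monom: "supp_from (monom_at le c a) a"
  by (simp add: supp_from_def proj_monom_at)

lemma supp_from_Ft: "supp_from (Ft i) (a0 i)"
proof -
  have "supp_from (u i) 0"
    unfolding supp_from_def
  proof (intro allI impI)
    fix b assume b: "proj (u i) le b \<noteq> 0"
    show "b - 0 \<in> word_sums E"
    proof (cases "b = 0")
      case False
      then have "b \<in> hsupp (proj (u i - 1) le)" using b by (simp add: hsupp_def hone_def)
      then show ?thesis using hsupp_u_minus_1 subset_word_sums by auto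
    qed simp
  qed
  then show ?thesis
    using supp_from_mult[OF supp_from_monom[of _ "a0 i"]] by (fastforce simp: Ft_eq \<mu>_def)
qed

lemma supp_from_Ft_inv: "supp_from (Ft_inv i) (- a0 i)"
proof -
  have "supp_from (u_inv i) 0" using hsupp_u_inv[of i] by (auto simp: supp_from_def hsupp_def)
  then show ?thesis
    using supp_from_mult[OF supp_from_monom[of _ "- a0 i"]] by (fastforce simp: Ft_inv_def \<mu>_inv_def)
qed

lemma supp_from_Ft_pow: "supp_from (Ft_pow k) (fendo le F (0, k))"
proof -
  have pow: "supp_from (X ^ m) (\<Sum>_\<in>{0..<m}. a)" if "supp_from X a" for X a m
    using supp_from_prod[of "{0..<m}" "\<lambda>_. X" "\<lambda>_. a"] that by simp
  have "supp_from (zpow (Ft i) (Ft_inv i) m) (zmul m (a0 i))" for i m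
    using pow[OF supp_from_Ft[of i], of "nat m"] pow[OF supp_from_Ft_inv[of i], of "nat (- m)"]
    by (simp add: zpow_def zmul_def sum_negf)
  then have "supp_from (Ft_pow k) (\<Sum>i\<in>UNIV. zmul (k $ i) (a0 i))"
    unfolding Ft_pow_def by (intro supp_from_prod) auto
  then show ?thesis by (simp add: fendo_eq_sum zero_prod_def[symmetric])
qed

section \<open>The Jacobians of the lifted series and their coefficients\<close>

definition LJt :: "('g \<times> (int^'n), 'k cover) hfam" where
  "LJt = det (\<chi> i. \<chi> j. Ft_inv i * Dx j (Ft i))"

definition Jt :: "('g \<times> (int^'n), 'k cover) hfam" where
  "Jt = det (\<chi> i. \<chi> j. x_inv j * Dx j (Ft i))"

text \<open>The factors \<open>x_inv j\<close> are pulled out of the columns, after transposition,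
  and the factors \<open>Ft_inv i\<close> out of the rows.\<close>

lemma Jt_eq: "Jt = (\<Prod>j\<in>UNIV. x_inv j) * ((\<Prod>i\<in>UNIV. Ft i) * LJt)"
proof -
  let ?d = "det (\<chi> i. \<chi> j. Dx j (Ft i))"
  have "Jt = det (transpose (\<chi> j. x_inv j *s (\<chi> i. Dx j (Ft i))))"
    unfolding Jt_def by (rule arg_cong[of _ _ det]) (simp add: vec_eq_iff transpose_def)
  also have "\<dots> = (\<Prod>j\<in>UNIV. x_inv j) * det (\<chi> j. \<chi> i. Dx j (Ft i))"
    unfolding det_transpose by (rule det_rows_mul)
  also have "det (\<chi> j. \<chi> i. Dx j (Ft i)) = det (transpose (\<chi> i. \<chi> j. Dx j (Ft i)))"
    by (simp add: transpose_def)
  finally have J: "Jt = (\<Prod>j\<in>UNIV. x_inv j) * ?d" by simp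
  have "LJt = det (\<chi> i. Ft_inv i *s (\<chi> j. Dx j (Ft i)))"
    unfolding LJt_def by (rule arg_cong[of _ _ det]) (simp add: vec_eq_iff)
  also have "\<dots> = (\<Prod>i\<in>UNIV. Ft_inv i) * ?d" by (rule det_rows_mul)
  finally have "(\<Prod>i\<in>UNIV. Ft i) * LJt = (\<Prod>i\<in>UNIV. Ft i * Ft_inv i) * ?d"
    by (simp add: prod.distrib mult.assoc)
  then show ?thesis by (simp add: J Ft_inverse)
qed

lemma jacobian_reduce: "jacobian F = reduce le Jt"
proof -
  have "jacobian F = hdet (\<lambda>i j. reduce le ((\<chi> i. \<chi> j. x_inv j * Dx j (Ft i)) $ i $ j))"
    unfolding jacobian_def by (simp add: hpderiv_reduce[symmetric] reduce_Ft)
  then show ?thesis unfolding hdet_reduce Jt_def .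
qed

lemma logjacobian_reduce: "logjacobian le F = reduce le LJt"
proof -
  have F: "hprod F = reduce le (\<Prod>i\<in>UNIV. Ft i)"
    using hprod_reduce[of le Ft] by (simp add: reduce_Ft)
  have "(\<Prod>i\<in>UNIV. Ft i) * (\<Prod>i\<in>UNIV. Ft_inv i) = 1"
    by (simp add: prod.distrib[symmetric] Ft_inverse)
  note inv = hinv_reduce[OF this]
  have X: "hprod xvar = reduce le (\<Prod>i\<in>UNIV. x i)"
    using hprod_reduce[of le x] by (simp add: xvar_reduce[abs_def])
  have "(\<Prod>i\<in>UNIV. x i) * (\<Prod>i\<in>UNIV. Ft_inv i) * Jt =
      (\<Prod>i\<in>UNIV. x i * x_inv i) * (\<Prod>i\<in>UNIV. Ft i * Ft_inv i) * LJt"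
    by (simp add: Jt_eq prod.distrib mult_ac)
  then have "(\<Prod>i\<in>UNIV. x i) * (\<Prod>i\<in>UNIV. Ft_inv i) * Jt = LJt"
    by (simp add: x_x_inv Ft_inverse)
  then show ?thesis
    unfolding logjacobian_def F inv X jacobian_reduce reduce_mult[symmetric] by simp
qed

text \<open>Nonzero \<open>k\<close> is the divergence argument; for \<open>k = 0\<close> each
  \<open>F i\<close> is replaced by its initial monomial, whose logarithmic derivative is its
  exponent vector.\<close>

lemma CT_power_LJt:
  "reduce le (Ft_pow k * LJt) (g, 0) = (if k = 0 \<and> g = 0 then of_int (jacnum le F) else 0)"
proof -
  interpret R: residue_functional Dx "\<lambda>X :: ('g \<times> (int^'n), 'k cover) hfam. proj X le (g, 0)"
    by (rule residue_functional_CT)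
  have LJ: "LJt = det (\<chi> l. R.dlog (Ft l) (Ft_inv l))"
    by (simp add: LJt_def R.dlog_def)
  show ?thesis
  proof (cases "k = 0")
    case False
    then obtain i where "k $ i \<noteq> 0" by (auto simp: vec_eq_iff)
    then have "proj (Ft_pow k * LJt) le (g, 0) = 0"
      using R.L_power_log_jacobian_eq_0[OF Ft_inverse, of "\<lambda>i. k $ i"] by (simp add: LJ Ft_pow_def)
    then show ?thesis using False by (simp add: reduce_def)
  next
    case True
    \<comment> \<open>Off \<open>le\<close> the monomials \<open>\<mu>\<close> are 1 with vanishing derivatives, hence the idempotent.\<close>
    define e :: "('g \<times> (int^'n), 'k cover) hfam" where "e = 1 - at_order le (\<lambda>_. 0)"
    have proj_e: "proj e le' = (if le' = le then hone else (\<lambda>_. 0))" for le'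
      by (cases "le' = le") (auto simp: e_def proj_at_order proj_at_order_other hsupp_def)
    have "proj LJt le (g, 0) = proj (det (\<chi> l. R.dlog (\<mu> l) (\<mu>_inv l))) le (g, 0)"
      unfolding LJ Ft_eq Ft_inv_def
      by (rule R.L_det_dlog_mult[OF \<mu>_inverse u_inverse])
        (rule power_mult_eventually_0[OF hsupp_u_minus_1])
    also have "(\<chi> l. R.dlog (\<mu> l) (\<mu>_inv l)) = (\<chi> l. e *s (\<chi> j. of_int (snd (a0 l) $ j)))"
    proof -
      \<comment> \<open>At \<open>le\<close> an Euler operator multiplies a monomial by its
        exponent; at the other relations both sides are \<open>0\<close>.\<close>
      have "\<mu>_inv l * Dx j (\<mu> l) = of_int (snd (a0 l) $ j) * e" for l j
      proof (rule hfam_eqI)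
        fix le' b
        show "proj (\<mu>_inv l * Dx j (\<mu> l)) le' b = proj (of_int (snd (a0 l) $ j) * e) le' b"
        proof (cases "le' = le")
          case True
          have "cover_lift (inverse (F l (a0 l))) * cover_lift (F l (a0 l)) = 1"
            using cover_lift_inverse[OF a0_supp] by (simp add: mult.commute)
          then show ?thesis
            unfolding True proj_of_int_mult proj_e \<mu>_inv_def proj_monom_at_mult
            by (simp add: Dx_def \<mu>_def proj_monom_at hone_def mult.left_commute)
        next
          case False
          have "proj (Dx j (\<mu> l)) le' = (\<lambda>_. 0)"
            using False
            by (intro ext) (simp add: Dx_def \<mu>_def monom_at_def proj_at_order_other hone_def)
          then have "proj (\<mu>_inv l * Dx j (\<mu> l)) le' b = 0"
            using False by (simp add: proj_mult \<mu>_inv_def monom_at_def proj_at_order_other)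
          then show ?thesis unfolding proj_of_int_mult proj_e using False by simp
        qed
      qed
      then show ?thesis by (simp add: vec_eq_iff R.dlog_def mult.commute)
    qed
    also have "det \<dots> = (\<Prod>l\<in>(UNIV :: 'n set). e) * det (\<chi> l. \<chi> j. of_int (snd (a0 l) $ j))"
      by (rule det_rows_mul)
    also have "det (\<chi> l. \<chi> j. (of_int (snd (a0 l) $ j) :: ('g \<times> (int^'n), 'k cover) hfam)) =
        of_int (jacnum le F)"
      by (simp add: jacnum_eq det_def)
    also have "(\<Prod>l\<in>(UNIV :: 'n set). e) * of_int (jacnum le F) = of_int (jacnum le F) * e ^ CARD('n)"
      by (simp add: mult.commute)
    also have "proj \<dots> le (g, 0) = of_int (jacnum le F) * hone (g, 0 :: int^'n)"
    proof -
      have "proj (e ^ m) le = hone" for m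
        by (induction m) (simp_all add: proj_mult proj_e)
      then show ?thesis by (simp only: proj_of_int_mult)
    qed
    finally show ?thesis using True
      by (auto simp: reduce_def Ft_pow_def cover_map_mult hone_def zero_prod_def)
  qed
qed

text \<open>Compared with the logarithmic Jacobian, the product of the \<open>F i\<close> raises
  \<open>k\<close> by the all-ones vector, and the inverse variables move the exponent read from
  \<open>- 1\<close> to \<open>0\<close>.\<close>

lemma Res_power_Jt:
  "reduce le (Ft_pow k * Jt) (g, - 1) = (if k = - 1 \<and> g = 0 then of_int (jacnum le F) else 0)"
proof -
  have "(\<Prod>i\<in>UNIV. Ft i) * Ft_pow k = Ft_pow (k + 1)"
    by (simp add: Ft_pow_def zpow_add_one[OF Ft_inverse] prod.distrib)
  then have "Ft_pow k * Jt = (\<Prod>j\<in>UNIV. x_inv j) * (Ft_pow (k + 1) * LJt)"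
    by (simp add: Jt_eq mult_ac)
  moreover have "(\<Sum>j\<in>UNIV. axis j 1) = (1 :: int^'n)"
    by (simp add: vec_eq_iff sum_component axis_def)
  ultimately have "reduce le (Ft_pow k * Jt) (g, - 1) = reduce le (Ft_pow (k + 1) * LJt) (g, 0)"
    by (simp add: reduce_def proj_prod_x_inv_mult)
  also have "\<dots> = (if k = - 1 \<and> g = 0 then of_int (jacnum le F) else 0)"
    unfolding CT_power_LJt by (simp add: add_eq_0_iff2)
  finally show ?thesis .
qed

section \<open>Substitution into \<open>Phi\<close>: summability and coefficient extraction\<close>

context
  fixes Phi :: "'g \<times> (int^'n) \<Rightarrow> 'k"
  assumes Phi: "Phi \<in> hahn (fle le F)"
begin

lemma good_support_fendo_image: "good_support le (fendo le F ` hsupp Phi)"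
proof -
  have "wo_on le (fendo le F ` hsupp Phi)"
    unfolding wo_on_def
  proof (intro allI impI)
    fix T assume T: "T \<subseteq> fendo le F ` hsupp Phi" "T \<noteq> {}"
    let ?S = "hsupp Phi \<inter> fendo le F -` T"
    have "?S \<noteq> {}" using T by blast
    moreover have "?S \<subseteq> hsupp Phi" by (rule Int_lower1)
    moreover have "wo_on (fle le F) (hsupp Phi)" using Phi by (simp add: hahn_def)
    ultimately obtain m where m: "m \<in> ?S" "\<forall>y\<in>?S. fle le F m y"
      unfolding wo_on_def by meson
    then have "\<forall>t\<in>T. fendo le F m \<preceq> t" using T(1) by (force simp: fle_def)
    then show "\<exists>m\<in>T. \<forall>t\<in>T. m \<preceq> t" using m(1) by blast
  qed
  then show ?thesis using toa by (simp add: good_support_iff)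
qed

text \<open>Since \<open>fendo\<close> fixes the first group, \<open>(g, 0)\<close> is the
  difference of the images of \<open>(g, k)\<close> and \<open>(0, k)\<close>, so this support lies
  in a translate of the image of the support of \<open>Phi\<close>.\<close>

lemma good_support_xcoeff: "good_support le (hsupp (xcoeff Phi k))"
proof (rule good_support_subset)
  show "good_support le {a + b |a b. a \<in> fendo le F ` hsupp Phi \<and> b \<in> {- fendo le F (0, k)}}"
    by (intro good_support_sums good_support_fendo_image good_support_singleton)
  show "hsupp (xcoeff Phi k) \<subseteq> {a + b |a b. a \<in> fendo le F ` hsupp Phi \<and> b \<in> {- fendo le F (0, k)}}"
  proof
    fix c assume c: "c \<in> hsupp (xcoeff Phi k)"
    then obtain g where g: "c = (g, 0)" "Phi (g, k) \<noteq> 0"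
      by (cases c) (auto simp: hsupp_def xcoeff_def split: if_splits)
    have "c = fendo le F (g, k) + - fendo le F (0, k)" unfolding fendo_split[of le F g k] g(1) by simp
    then show "c \<in> {a + b |a b. a \<in> fendo le F ` hsupp Phi \<and> b \<in> {- fendo le F (0, k)}}"
      using g(2) unfolding hsupp_def by blast
  qed
qed

lemma subst_terms_eq: "subst_terms le Phi F k = hmul (xcoeff Phi k) (reduce le (Ft_pow k))"
  by (simp add: subst_terms_def Fpow_reduce)

lemma subst_terms_supp:
  assumes "subst_terms le Phi F k c \<noteq> 0"
  obtains g where "Phi (g, k) \<noteq> 0" "c - fendo le F (g, k) \<in> word_sums E"
proof -
  have "c \<in> hsupp (hmul (xcoeff Phi k) (reduce le (Ft_pow k)))"
    using assms by (simp add: hsupp_def subst_terms_eq)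
  then obtain a b where ab: "c = a + b" "a \<in> hsupp (xcoeff Phi k)" "b \<in> hsupp (reduce le (Ft_pow k))"
    by (rule hsupp_hmulE)
  obtain g where g: "a = (g, 0)" "Phi (g, k) \<noteq> 0"
    using ab(2) by (cases a) (auto simp: hsupp_def xcoeff_def split: if_splits)
  have "b - fendo le F (0, k) \<in> word_sums E"
    using supp_from_Ft_pow[of k] ab(3) hsupp_reduce[of le "Ft_pow k"]
    unfolding supp_from_def hsupp_def by blast
  moreover have "c - fendo le F (g, k) = b - fendo le F (0, k)"
    unfolding fendo_split[of le F g k] ab(1) g(1) by simp
  ultimately show ?thesis using that g(2) by metis
qed

lemma good_support_word_sums: "good_support le (word_sums E)"
  using wo_word_sums toa by (simp add: good_support_iff)

text \<open>All terms are supported in the sumset of the well-ordered image of the support of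
  \<open>Phi\<close> and the monoid \<open>word_sums E\<close>, where each exponent has finitely
  many decompositions.\<close>

lemma subst_terms_summable:
  shows "good_support le (\<Union>k. hsupp (subst_terms le Phi F k))"
    and "finite {k. subst_terms le Phi F k c \<noteq> 0}"
proof -
  show "good_support le (\<Union>k. hsupp (subst_terms le Phi F k))"
  proof (rule good_support_subset)
    show "good_support le {a + b |a b. a \<in> fendo le F ` hsupp Phi \<and> b \<in> word_sums E}"
      by (intro good_support_sums good_support_fendo_image good_support_word_sums)
    show "(\<Union>k. hsupp (subst_terms le Phi F k)) \<subseteq>
        {a + b |a b. a \<in> fendo le F ` hsupp Phi \<and> b \<in> word_sums E}"
    proof
      fix c assume "c \<in> (\<Union>k. hsupp (subst_terms le Phi F k))"
      then obtain k where "subst_terms le Phi F k c \<noteq> 0" by (auto simp: hsupp_def)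
      then obtain g where "Phi (g, k) \<noteq> 0" "c - fendo le F (g, k) \<in> word_sums E"
        by (rule subst_terms_supp)
      moreover have "c = fendo le F (g, k) + (c - fendo le F (g, k))" by simp
      ultimately show "c \<in> {a + b |a b. a \<in> fendo le F ` hsupp Phi \<and> b \<in> word_sums E}"
        unfolding hsupp_def by blast
    qed
  qed
  have "finite {a \<in> fendo le F ` hsupp Phi. c - a \<in> word_sums E}"
    by (rule good_support_finite[OF good_support_fendo_image good_support_word_sums])
  \<comment> \<open>Injectivity of \<open>fendo\<close> recovers \<open>k\<close> from the first
    summand of a decomposition.\<close>
  then have "finite (snd ` (fendo le F -` {a \<in> fendo le F ` hsupp Phi. c - a \<in> word_sums E}))"
    by (intro finite_imageI finite_vimageI fendo_inj)
  then show "finite {k. subst_terms le Phi F k c \<noteq> 0}"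
  proof (rule finite_subset[rotated])
    show "{k. subst_terms le Phi F k c \<noteq> 0} \<subseteq>
        snd ` (fendo le F -` {a \<in> fendo le F ` hsupp Phi. c - a \<in> word_sums E})"
    proof
      fix k assume "k \<in> {k. subst_terms le Phi F k c \<noteq> 0}"
      then have "subst_terms le Phi F k c \<noteq> 0" by simp
      then obtain g where "Phi (g, k) \<noteq> 0" "c - fendo le F (g, k) \<in> word_sums E"
        by (rule subst_terms_supp)
      then show "k \<in> snd ` (fendo le F -` {a \<in> fendo le F ` hsupp Phi. c - a \<in> word_sums E})"
        by (intro image_eqI[of _ _ "(g, k)"]) (auto simp: hsupp_def)
    qed
  qed
qed

lemma hsummable_subst_terms: "hsummable le (subst_terms le Phi F) UNIV"
proof -
  have "subst_terms le Phi F k \<in> hahn le" for k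
    unfolding hahn_iff subst_terms_eq by (intro good_support_hmul good_support_xcoeff good_support_reduce)
  moreover have "wo_on le (\<Union>k. hsupp (subst_terms le Phi F k))"
    using subst_terms_summable(1) toa by (simp add: good_support_iff)
  ultimately show ?thesis using subst_terms_summable(2) by (simp add: hsummable_def)
qed

text \<open>The product is formed term by term. The hypothesis leaves the index \<open>k0\<close>
  alone and makes the coefficient at \<open>x^h\<close> the scalar \<open>v\<close>.\<close>

lemma hmul_subst:
  assumes "\<And>k g. reduce le (Ft_pow k * \<eta>) (g, h) = (if k = k0 \<and> g = 0 then v else 0)"
  shows "hmul (subst le Phi F) (reduce le \<eta>) (g, h) = v * Phi (g, k0)"
proof -
  have coeff: "hmul (subst_terms le Phi F k) (reduce le \<eta>) (g, h) = (if k = k0 then v * Phi (g, k0) else 0)"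
    for k
  proof -
    have "hmul (subst_terms le Phi F k) (reduce le \<eta>) = hmul (xcoeff Phi k) (reduce le (Ft_pow k * \<eta>))"
      unfolding subst_terms_eq reduce_mult
      by (rule hmul_assoc[OF good_support_xcoeff good_support_reduce good_support_reduce])
    then have "hmul (subst_terms le Phi F k) (reduce le \<eta>) (g, h) =
        hmul (xcoeff Phi k) (reduce le (Ft_pow k * \<eta>)) (g, h)"
      by simp
    \<comment> \<open>The first factor has no \<open>x\<close> in it, and the second vanishes at
      \<open>x^h\<close> unless its first exponent is \<open>0\<close>.\<close>
    also have "\<dots> = (\<Sum>a\<in>{(g, 0)}. xcoeff Phi k a * reduce le (Ft_pow k * \<eta>) ((g, h) - a))"
    proof (rule hmul_eq_sum)
      show "{a. xcoeff Phi k a \<noteq> 0 \<and> reduce le (Ft_pow k * \<eta>) ((g, h) - a) \<noteq> 0} \<subseteq> {(g, 0)}"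
        by (auto simp: xcoeff_def assms split: if_splits)
    qed simp
    finally show ?thesis by (simp add: xcoeff_def assms)
  qed
  have "hmul (subst le Phi F) (reduce le \<eta>) (g, h) =
      hsum (\<lambda>k. hmul (subst_terms le Phi F k) (reduce le \<eta>)) UNIV (g, h)"
    unfolding subst_def
    by (rule fun_cong[OF hmul_hsum[OF _ _ good_support_reduce]]) (simp_all add: subst_terms_summable)
  also have "\<dots> = (\<Sum>k\<in>{k0}. hmul (subst_terms le Phi F k) (reduce le \<eta>) (g, h))"
    by (rule hsum_superset) (auto simp: coeff)
  finally show ?thesis by (simp add: coeff)
qed

lemma residue_theorem:
  shows "Resx (hmul (subst le Phi F) (jacobian F)) = (\<lambda>g. of_int (jacnum le F) * Phi (g, - 1))"
    and "CTx (hmul (subst le Phi F) (logjacobian le F)) = (\<lambda>g. of_int (jacnum le F) * Phi (g, 0))"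
  unfolding Resx_def CTx_def jacobian_reduce logjacobian_reduce
  using hmul_subst[OF Res_power_Jt] hmul_subst[OF CT_power_LJt] by auto

end

end

theorem mainTheorem6:
  fixes le :: "'g::ab_group_add \<times> (int^'n::finite) \<Rightarrow> 'g \<times> (int^'n) \<Rightarrow> bool"
    and F :: "'n \<Rightarrow> 'g \<times> (int^'n) \<Rightarrow> 'k::field"
    and Phi :: "'g \<times> (int^'n) \<Rightarrow> 'k"
  assumes "toa le"
    and "\<And>i. F i \<in> hahn le"
    and "\<And>i. F i \<noteq> (\<lambda>_. 0)"
    and "jacnum le F \<noteq> 0"
    and "Phi \<in> hahn (fle le F)"
  shows "hsummable le (subst_terms le Phi F) UNIV
    \<and> Resx (hmul (subst le Phi F) (jacobian F)) = (\<lambda>g. of_int (jacnum le F) * Phi (g, - 1))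
    \<and> CTx (hmul (subst le Phi F) (logjacobian le F)) = (\<lambda>g. of_int (jacnum le F) * Phi (g, 0))"
proof -
  interpret residue_setting le F
    by unfold_locales (use assms in auto)
  show ?thesis
    using hsummable_subst_terms[OF assms(5)] residue_theorem[OF assms(5)] by blast
qed

end
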